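(* Let $\Omega,\lambda>0$, and let $X=\{x_k:k\in\mathbb{Z}\}\subseteq\mathbb{R}$ be a uniformly separated set with lower Beurling density $D^-(X)>\Omega$. Then the folded sampling operator $$\mathcal{M}_{\lambda,X}:PW_\Omega(\mathbb{R})\to\ell^2_\lambda(\mathbb{Z}),\qquad f\mapsto(\mathcal{M}_\lambda f(x_k))_{k\in\mathbb{Z}},$$ is injective.
   Context: Fourier transform: $\hat f(\xi)=\int_{\mathbb{R}}f(t)e^{-2\pi i t\xi}\,dt$. The Paley-Wiener space is $PW_\Omega(\mathbb{R})=\{f\in L^2(\mathbb{R}):\hat f=0\text{ a.e. outside }[-\Omega/2,\Omega/2]\}$; its (complex-valued) elements are identified with their continuous representatives. $X=\{x_k:k\in\mathbb{Z}\}$ is an enumerated set (distinct indices give distinct points); it is uniformly separated if $\inf_{x,y\in X,\,x\neq y}|x-y|>0$. Its lower Beurling density is $D^-(X)=\liminf_{r\to\infty}\inf_{t\in\mathbb{R}}\frac{\#(X\cap[t-r,t+r])}{2r}$. Folding: for real $x$, $\mathcal{M}_\lambda(x)$ is the unique number in $[-\lambda,\lambda)$ with $x-\mathcal{M}_\lambda(x)\in 2\lambda\mathbb{Z}$; for complex numbers, $\mathcal{M}_\lambda(x+iy)=\mathcal{M}_\lambda(x)+i\mathcal{M}_\lambda(y)$. As a set, $\ell^2_\lambda(\mathbb{Z})=\{a\in\ell^2(\mathbb{Z}): a_k\in[-\lambda,\lambda)+i[-\lambda,\lambda)\ \forall k\}$. *)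

theory Defs
  imports "HOL-Analysis.Analysis"
begin

definition fourier_transform :: "(real \<Rightarrow> complex) \<Rightarrow> real \<Rightarrow> complex" where
  "fourier_transform f \<xi> = (LINT t|lborel. f t * cis (- (2 * pi * t * \<xi>)))"

definition square_integrable :: "(real \<Rightarrow> complex) \<Rightarrow> bool" where
  "square_integrable f \<longleftrightarrow>
     f \<in> borel_measurable lborel \<and> integrable lborel (\<lambda>t. (cmod (f t))\<^sup>2)"

text \<open>
  The Fourier integral of a square-integrable function need not converge absolutely, so its
  transform is taken in the sense of Plancherel: it is the limit in \<open>L\<^sup>2\<close>, unique up to null sets,
  of the transforms of the truncations to \<open>[-R, R]\<close>, which are integrable. The error is an
  extended nonnegative integral, so that it cannot vanish merely by failing to be integrable.
\<close>

definition has_L2_fourier_transform :: "(real \<Rightarrow> complex) \<Rightarrow> (real \<Rightarrow> complex) \<Rightarrow> bool" where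
  "has_L2_fourier_transform f g \<longleftrightarrow>
     square_integrable f \<and> square_integrable g \<and>
     ((\<lambda>R::real. \<integral>\<^sup>+\<xi>. ennreal
          ((cmod (fourier_transform (\<lambda>t. indicator {-R..R} t * f t) \<xi> - g \<xi>))\<^sup>2) \<partial>lborel)
        \<longlongrightarrow> 0) at_top"

text \<open>
  Elements of the Paley-Wiener space are represented by their continuous representatives, so
  equality in the space is equality of functions.
\<close>

definition paley_wiener :: "real \<Rightarrow> (real \<Rightarrow> complex) set" where
  "paley_wiener \<Omega> = {f. continuous_on UNIV f \<and> square_integrable f \<and>
     (\<exists>g. has_L2_fourier_transform f g \<and>
          (AE \<xi> in lborel. \<xi> \<notin> {-\<Omega>/2..\<Omega>/2} \<longrightarrow> g \<xi> = 0))}"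

definition uniformly_separated :: "real set \<Rightarrow> bool" where
  "uniformly_separated X \<longleftrightarrow>
     0 < (INF (x, y)\<in>{(x, y). x \<in> X \<and> y \<in> X \<and> x \<noteq> y}. ennreal \<bar>x - y\<bar>)"

text \<open>
  Points are counted with the counting measure rather than with \<open>card\<close>, which is 0 on
  infinite sets.
\<close>

definition lower_beurling_density :: "real set \<Rightarrow> ennreal" where
  "lower_beurling_density X =
     Liminf at_top (\<lambda>r::real. INF t::real.
       emeasure (count_space UNIV) (X \<inter> {t - r..t + r}) / ennreal (2 * r))"

definition real_folding :: "real \<Rightarrow> real \<Rightarrow> real" where
  "real_folding lam x = (THE y. y \<in> {-lam..<lam} \<and> (\<exists>n::int. x - y = 2 * lam * of_int n))"

definition folding :: "real \<Rightarrow> complex \<Rightarrow> complex" where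
  "folding lam z = Complex (real_folding lam (Re z)) (real_folding lam (Im z))"

lemma real_folding_unique:
  fixes lam x :: real
  assumes "lam > 0"
  shows "\<exists>!y. y \<in> {-lam..<lam} \<and> (\<exists>n::int. x - y = 2 * lam * of_int n)"
proof (rule ex_ex1I)
  define n where "n = \<lfloor>(x + lam) / (2 * lam)\<rfloor>"
  have "of_int n \<le> (x + lam) / (2 * lam)" "(x + lam) / (2 * lam) < of_int n + 1"
    unfolding n_def by linarith+
  then have "x - 2 * lam * of_int n \<in> {-lam..<lam}"
    using assms by (simp add: field_simps)
  then show "\<exists>y. y \<in> {-lam..<lam} \<and> (\<exists>n::int. x - y = 2 * lam * of_int n)"
    by (intro exI[of _ "x - 2 * lam * of_int n"]) auto
next
  fix y z
  assume y: "y \<in> {-lam..<lam} \<and> (\<exists>n::int. x - y = 2 * lam * of_int n)"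
    and z: "z \<in> {-lam..<lam} \<and> (\<exists>n::int. x - z = 2 * lam * of_int n)"
  then obtain m n :: int where "x - y = 2 * lam * of_int m" "x - z = 2 * lam * of_int n"
    by blast
  then have eq: "z - y = 2 * lam * of_int (m - n)"
    by (simp add: algebra_simps)
  have "\<bar>z - y\<bar> < 2 * lam"
    using y z by auto
  then have "2 * lam * \<bar>of_int (m - n)\<bar> < 2 * lam * 1"
    unfolding eq using assms by (simp add: abs_mult)
  then have "\<bar>of_int (m - n) :: real\<bar> < 1"
    using assms by (simp only: mult_less_cancel_left_pos)
  then have "m = n"
    by linarith
  then show "y = z"
    using eq by simp
qed

definition folded_ell2 :: "real \<Rightarrow> (int \<Rightarrow> complex) set" where
  "folded_ell2 lam = {a. (\<lambda>k. (cmod (a k))\<^sup>2) summable_on UNIV \<and>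
     (\<forall>k. Re (a k) \<in> {-lam..<lam} \<and> Im (a k) \<in> {-lam..<lam})}"

definition folded_sampling ::
    "real \<Rightarrow> (int \<Rightarrow> real) \<Rightarrow> (real \<Rightarrow> complex) \<Rightarrow> int \<Rightarrow> complex" where
  "folded_sampling lam x f = (\<lambda>k. folding lam (f (x k)))"

end

theory Submission
  imports Defs "HOL-Complex_Analysis.Complex_Analysis" "HOL-Probability.Characteristic_Functions"
begin

text \<open>
  Let \<open>h\<close> be the difference of two functions in the Paley-Wiener space whose folded samples agree.
  Every sample \<open>h (x k)\<close> lies in the lattice \<open>2 lam (\<int> + i \<int>)\<close>. By the Plancherel-Polya inequality
  (\<open>bandlimited_samples_square_bounded\<close>) the samples are square summable, so all but finitely many of
  them vanish. Removing finitely many points does not change the lower Beurling density; so \<open>h\<close>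
  vanishes on a set of density greater than \<open>\<Omega>\<close>, and it remains to see that such a set is a
  uniqueness set. The same inequality shows that the operator takes values in the square summable
  sequences, because folding does not increase absolute values.

  For uniqueness, \<open>h\<close> extends to an entire function with \<open>\<bar>h z\<bar> \<le> C exp (\<pi> \<Omega> \<bar>Im z\<bar>)\<close>
  (\<open>bandlimited_entire_extension\<close>). If \<open>h t \<noteq> 0\<close> for some real \<open>t\<close>, Jensen's inequality
  (\<open>jensen_exponential_type\<close>) on the disc of radius \<open>R\<close> around \<open>t\<close> bounds the sum of \<open>ln (R / \<bar>s - t\<bar>)\<close>
  over the zeros \<open>s\<close> by \<open>2 \<Omega> R + O(1)\<close>, whereas zeros of density \<open>D > \<Omega>\<close> on the real line make that sum
  grow at least like \<open>2 D R\<close>.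

  Jensen's inequality is derived from the maximum principle and an explicit harmonic majorant of
  \<open>\<bar>Im z\<bar>\<close> (\<open>harmonic_majorant_of_abs_Im\<close>). The link between the \<open>L\<^sup>2\<close> definition of the Paley-Wiener space
  and absolutely convergent integrals is \<open>paley_wiener_representation\<close>: pairing with Gaussians turns
  the \<open>L\<^sup>2\<close> limit that defines the transform into pointwise Fourier inversion.
\<close>

section \<open>Jensen's inequality and the density of real zeros\<close>

lemma divide_out_finite_zeros:
  fixes f :: "complex \<Rightarrow> complex"
  assumes "finite S" "f holomorphic_on A" "open A" "S \<subseteq> A" "\<And>s. s \<in> S \<Longrightarrow> f s = 0"
  obtains q where "q holomorphic_on A" "\<And>z. z \<in> A \<Longrightarrow> f z = q z * (\<Prod>s\<in>S. z - s)"
proof -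
  have "\<exists>q. q holomorphic_on A \<and> (\<forall>z\<in>A. f z = q z * (\<Prod>s\<in>S. z - s))"
    using assms(1,4,5)
  proof (induction S rule: finite_induct)
    case empty
    then show ?case using assms by auto
  next
    case (insert a S)
    then obtain q where q: "q holomorphic_on A" "\<forall>z\<in>A. f z = q z * (\<Prod>s\<in>S. z - s)"
      by auto
    have "q a * (\<Prod>s\<in>S. a - s) = 0"
      using q(2) insert.prems by auto
    then have qa: "q a = 0"
      using insert.hyps by auto
    define p where "p = (\<lambda>z. if z = a then deriv q a else (q z - q a) / (z - a))"
    have "p holomorphic_on A"
      unfolding p_def by (rule pole_lemma_open[OF q(1) \<open>open A\<close>])
    moreover have "q z = p z * (z - a)" for z
      using qa by (auto simp: p_def)
    ultimately show ?case
      using q(2) insert.hyps by (intro exI[of _ p]) (auto simp: mult.assoc)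
  qed
  then show ?thesis using that by blast
qed

text \<open>
  The function is \<open>k w = (1 - w\<^sup>2) artanh w / w\<close>. On the unit circle, at \<open>w = exp (i \<theta>)\<close>, the factor
  \<open>1 / w - w\<close> equals \<open>- 2 i sin \<theta>\<close> and \<open>artanh w\<close> has imaginary part \<open>\<pi> / 4\<close> with the sign of
  \<open>sin \<theta>\<close>; hence \<open>Re k = (\<pi> / 2) \<bar>sin \<theta>\<bar>\<close> there. So \<open>(2 / \<pi>) Re k\<close> is the harmonic extension of \<open>\<bar>Im\<bar>\<close>
  from the circle, and its value \<open>2 / \<pi>\<close> at the centre is the mean of \<open>\<bar>sin\<bar>\<close>. Only an inequality
  inside the disc is stated, with an error that vanishes at the boundary: this avoids boundary
  values at the two logarithmic singularities \<open>1\<close> and \<open>- 1\<close>.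
\<close>

lemma harmonic_majorant_of_abs_Im:
  obtains k where "k holomorphic_on ball 0 1" "k 0 = 1"
    "\<And>w. w \<in> ball 0 1 \<Longrightarrow> Re (k w) \<ge> pi / 2 * \<bar>Im w\<bar> - (1 - (cmod w)\<^sup>2) / 2"
proof -
  define u where "u = (\<lambda>w::complex. (1 + w) / (1 - w))"
  \<comment> \<open>This is \<open>artanh\<close>; the argument of the logarithm has positive real part on the disc.\<close>
  define L where "L = (\<lambda>w. Ln (u w) / 2)"
  have Reu: "Re (u w) = (1 - (cmod w)\<^sup>2) / (cmod (1 - w))\<^sup>2" and
       Imu: "Im (u w) = 2 * Im w / (cmod (1 - w))\<^sup>2" for w
    unfolding u_def Re_divide Im_divide cmod_power2
    by (auto simp: power2_eq_square algebra_simps)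
  have ne1: "1 - w \<noteq> 0" and cw: "(cmod w)\<^sup>2 < 1" if "w \<in> ball 0 1" for w :: complex
  proof -
    show "1 - w \<noteq> 0" using that by auto
    show "(cmod w)\<^sup>2 < 1" using that by (simp add: power_less_one_iff)
  qed
  have Reu_pos: "Re (u w) > 0" if "w \<in> ball 0 1" for w
    unfolding Reu using ne1[OF that] cw[OF that] by (intro divide_pos_pos) auto
  have holL: "L holomorphic_on ball 0 1"
    unfolding L_def u_def
  proof (intro holomorphic_intros)
    fix w :: complex assume w: "w \<in> ball 0 1"
    show "1 - w \<noteq> 0" using ne1[OF w] .
    show "(1 + w) / (1 - w) \<notin> \<real>\<^sub>\<le>\<^sub>0"
      using Reu_pos[OF w] by (auto simp: u_def complex_nonpos_Reals_iff)
  qed auto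
  have L0: "L 0 = 0" by (simp add: L_def u_def)
  have dL: "deriv L 0 = 1"
    unfolding L_def u_def
    by (rule DERIV_imp_deriv) (auto intro!: derivative_eq_intros)
  define q where "q = (\<lambda>z. if z = 0 then deriv L 0 else (L z - L 0) / (z - 0))"
  have holq: "q holomorphic_on ball 0 1"
    unfolding q_def by (rule pole_lemma_open[OF holL]) auto
  define k where "k = (\<lambda>w. (1 - w\<^sup>2) * q w)"
  show ?thesis
  proof
    show "k holomorphic_on ball 0 1" unfolding k_def by (intro holomorphic_intros holq)
    show "k 0 = 1" by (simp add: k_def q_def dL)
    fix w :: complex assume w: "w \<in> ball 0 1"
    show "Re (k w) \<ge> pi / 2 * \<bar>Im w\<bar> - (1 - (cmod w)\<^sup>2) / 2"
    proof (cases "w = 0")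
      case True then show ?thesis by (simp add: k_def q_def dL)
    next
      case False
      define x y r2 where "x = Re w" "y = Im w" "r2 = (cmod w)\<^sup>2"
      have r2: "0 < r2" "r2 < 1" using False cw[OF w] by (auto simp: x_y_r2_def)
      define A B where "A = Re (L w)" "B = Im (L w)"
      have kw: "k w = (1 / w - w) * L w"
        using False by (simp add: k_def q_def L0 field_simps power2_eq_square)
      have Rew: "Re (1 / w - w) = x * (1 / r2 - 1)" and Imw: "Im (1 / w - w) = - (y * (1 / r2 + 1))"
        by (auto simp: Re_divide Im_divide x_y_r2_def cmod_power2 algebra_simps)
      have Rek: "Re (k w) = x * A * (1 / r2 - 1) + y * B * (1 / r2 + 1)"
        unfolding kw times_complex.sel Rew Imw A_B_def by (simp add: algebra_simps)
      have u0: "u w \<noteq> 0" using Reu_pos[OF w] by auto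
      have A: "A = ln (cmod (1 + w) / cmod (1 - w)) / 2"
        using u0 by (simp add: A_B_def L_def u_def norm_divide)
      \<comment> \<open>The part coming from \<open>Re (artanh w)\<close> has the right sign; the main term is the one with \<open>y * B\<close>.\<close>
      have sgnA: "x * A \<ge> 0"
      proof (cases "x \<ge> 0")
        case True
        have "(cmod (1 - w))\<^sup>2 \<le> (cmod (1 + w))\<^sup>2"
          unfolding cmod_power2 using True by (simp add: x_y_r2_def power2_eq_square algebra_simps)
        then have "cmod (1 - w) \<le> cmod (1 + w)" by (rule power2_le_imp_le) simp
        then have "A \<ge> 0" using ne1[OF w] unfolding A by simp
        then show ?thesis using True by simp
      next
        case False
        have "(cmod (1 + w))\<^sup>2 \<le> (cmod (1 - w))\<^sup>2"
          unfolding cmod_power2 using False by (simp add: x_y_r2_def power2_eq_square algebra_simps)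
        then have "cmod (1 + w) \<le> cmod (1 - w)" by (rule power2_le_imp_le) simp
        moreover have "1 + w \<noteq> 0" using u0 by (auto simp: u_def)
        ultimately have "A \<le> 0" using ne1[OF w] unfolding A by simp
        then show ?thesis using False by (simp add: mult_nonpos_nonpos)
      qed
      have B: "B = arctan (2 * y / (1 - r2)) / 2"
      proof -
        have "Im (Ln (u w)) = arctan (Im (u w) / Re (u w))"
          using Reu_pos[OF w] by (metis Arg_eq_Im_Ln arg_conv_arctan u0)
        also have "Im (u w) / Re (u w) = 2 * y / (1 - r2)"
          unfolding Reu Imu using ne1[OF w] by (simp add: x_y_r2_def)
        finally show ?thesis by (simp add: A_B_def L_def)
      qed
      have yB: "y * B \<ge> \<bar>y\<bar> * pi / 4 - (1 - r2) / 4"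
      proof -
        have pos: "y * (arctan (2 * y / (1 - r2)) / 2) \<ge> \<bar>y\<bar> * pi / 4 - (1 - r2) / 4" if "y > 0" for y
        proof -
          define v where "v = 2 * y / (1 - r2)"
          have v: "v > 0" using that r2 by (simp add: v_def)
          \<comment> \<open>How far \<open>arctan v\<close> is from its limit \<open>\<pi> / 2\<close> as \<open>w\<close> tends to the circle.\<close>
          have "arctan (1 / v) \<le> 1 / v" using v by (intro arctan_le_self) auto
          moreover have "arctan (1 / v) = pi / 2 - arctan v"
            using v arctan_inverse[of v] by (simp add: inverse_eq_divide)
          ultimately have "arctan v \<ge> pi / 2 - (1 - r2) / (2 * y)" by (simp add: v_def)
          then have "y / 2 * arctan v \<ge> y / 2 * (pi / 2 - (1 - r2) / (2 * y))"
            using that by (intro mult_left_mono) auto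
          moreover have "y / 2 * (pi / 2 - (1 - r2) / (2 * y)) = y * pi / 4 - (1 - r2) / 4"
            using that by (simp add: field_simps)
          ultimately have "y * pi / 4 - (1 - r2) / 4 \<le> y / 2 * arctan v" by linarith
          then show ?thesis using that by (simp add: v_def)
        qed
        consider "y > 0" | "y = 0" | "y < 0" by linarith
        then show ?thesis
        proof cases
          case 1 then show ?thesis using pos[of y] by (simp add: B)
        next
          case 2 then show ?thesis using r2 by (simp add: B)
        next
          case 3
          have "arctan (2 * (-y) / (1 - r2)) = - arctan (2 * y / (1 - r2))"
            by (simp flip: arctan_minus)
          then show ?thesis using 3 pos[of "-y"] by (simp add: B)
        qed
      qed
      have yB0: "y * B \<ge> 0"
      proof (cases "y \<ge> 0")
        case True
        then have "arctan (2 * y / (1 - r2)) \<ge> 0" using r2 by simp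
        then show ?thesis using True by (simp add: B)
      next
        case False
        then have "arctan (2 * y / (1 - r2)) \<le> 0" using r2 by (simp add: divide_nonpos_pos)
        then show ?thesis using False by (simp add: B mult_nonpos_nonpos)
      qed
      have "1 / r2 \<ge> 1" using r2 by simp
      then have "y * B * (1 / r2 + 1) \<ge> y * B * 2" using yB0 by (intro mult_left_mono) auto
      moreover have "x * A * (1 / r2 - 1) \<ge> 0" using sgnA \<open>1 / r2 \<ge> 1\<close> by simp
      moreover have "(\<bar>y\<bar> * pi / 4 - (1 - r2) / 4) * 2 \<le> y * B * 2"
        by (rule mult_right_mono[OF yB]) simp
      ultimately have "(\<bar>y\<bar> * pi / 4 - (1 - r2) / 4) * 2 \<le> Re (k w)"
        unfolding Rek by (meson add_increasing order_trans)
      then show ?thesis by (simp add: x_y_r2_def field_simps)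
    qed
  qed
qed


text \<open>
  Jensen's inequality for a function that grows like \<open>exp (a \<bar>Im z\<bar>)\<close>: the mean of \<open>a \<bar>Im z\<bar>\<close> over the
  circle of radius \<open>R\<close> is \<open>2 a R / \<pi>\<close>. Divide out the zeros and put the factors \<open>(R\<^sup>2 - cnj s z) / R\<close>
  in their place, which have the same modulus \<open>\<bar>z - s\<bar>\<close> on the circle. Multiplication by
  \<open>exp (- a G)\<close>, where \<open>Re G\<close> majorises \<open>\<bar>Im z\<bar>\<close> on the circle, leaves a function bounded by \<open>C\<close> there,
  and the maximum principle compares this bound with the value at \<open>0\<close>.
\<close>

lemma jensen_exponential_type:
  fixes F :: "complex \<Rightarrow> complex" and S :: "complex set"
  assumes F: "F holomorphic_on UNIV" and a: "a \<ge> 0" and R: "R > 0"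
    and bound: "\<And>z. cmod z = R \<Longrightarrow> cmod (F z) \<le> C * exp (a * \<bar>Im z\<bar>)"
    and S: "finite S" "0 \<notin> S" "\<And>s. s \<in> S \<Longrightarrow> F s = 0"
  shows "cmod (F 0) * (\<Prod>s\<in>S. R / cmod s) \<le> C * exp (2 * a * R / pi)"
proof -
  obtain q where q: "q holomorphic_on UNIV" and Fq: "\<And>z. F z = q z * (\<Prod>s\<in>S. z - s)"
    using divide_out_finite_zeros[OF S(1) F] S(3) by auto
  obtain k where k: "k holomorphic_on ball 0 1" "k 0 = 1"
    and Rek: "\<And>w. w \<in> ball 0 1 \<Longrightarrow> Re (k w) \<ge> pi / 2 * \<bar>Im w\<bar> - (1 - (cmod w)\<^sup>2) / 2"
    using harmonic_majorant_of_abs_Im by metis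
  have main: "cmod (F 0) * (\<Prod>s\<in>S. R / cmod s) \<le> C * exp (a * (R / \<rho> * (2 / pi) * (1 + (1 - \<rho>\<^sup>2) / 2)))"
    if \<rho>: "0 < \<rho>" "\<rho> < 1" for \<rho> :: real
  proof -
    \<comment> \<open>The scaling by \<open>\<rho> < 1\<close> moves the closed disc into the domain of \<open>k\<close>; the limit \<open>\<rho> \<rightarrow> 1\<close> is
      taken at the end. The added constant cancels the error term in the bound for \<open>Re k\<close>.\<close>
    define G where "G = (\<lambda>z. of_real (R / \<rho> * (2 / pi)) * (k (of_real (\<rho> / R) * z) + of_real ((1 - \<rho>\<^sup>2) / 2)))"
    define H where "H = (\<lambda>z. q z * (\<Prod>s\<in>S. (of_real (R\<^sup>2) - cnj s * z) / of_real R) * exp (- of_real a * G z))"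
    have inball: "of_real (\<rho> / R) * z \<in> ball 0 1" if "z \<in> cball 0 R" for z :: complex
    proof -
      have "\<rho> / R * cmod z \<le> \<rho> / R * R"
        using that \<rho> R by (intro mult_left_mono) auto
      also have "\<dots> < 1" using \<rho> R by simp
      finally show ?thesis using \<rho> R by (simp add: norm_mult norm_divide)
    qed
    have holG: "G holomorphic_on cball 0 R"
      unfolding G_def
      by (intro holomorphic_intros holomorphic_on_compose_gen[OF _ k(1), unfolded o_def])
         (use inball in auto)
    have holH: "H holomorphic_on cball 0 R"
      unfolding H_def using R
      by (intro holomorphic_intros holomorphic_on_subset[OF q] holG) auto
    have "cmod (H 0) \<le> C"
    proof (rule maximum_modulus_frontier[of H "cball 0 R"])
      show "H holomorphic_on interior (cball 0 R)"
        using holH holomorphic_on_subset interior_subset by blast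
      show "continuous_on (closure (cball 0 R)) H"
        using holH by (simp add: holomorphic_on_imp_continuous_on)
      show "0 \<in> cball (0::complex) R" using R by simp
      fix z :: complex assume "z \<in> frontier (cball 0 R)"
      then have z: "cmod z = R" using R by (simp add: frontier_cball)
      have zz: "of_real (R\<^sup>2) = z * cnj z"
        using z complex_norm_square[of z] by simp
      have prod: "cmod (\<Prod>s\<in>S. (of_real (R\<^sup>2) - cnj s * z) / of_real R) = cmod (\<Prod>s\<in>S. z - s)"
        unfolding prod_norm [symmetric]
      proof (rule prod.cong)
        fix s
        have "of_real (R\<^sup>2) - cnj s * z = z * cnj (z - s)"
          unfolding zz by (simp add: algebra_simps)
        then show "cmod ((of_real (R\<^sup>2) - cnj s * z) / of_real R) = cmod (z - s)"
          using z R by (simp add: norm_mult norm_divide flip: complex_cnj_diff)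
      qed simp
      have ReG: "Re (G z) \<ge> \<bar>Im z\<bar>"
      proof -
        define w where "w = of_real (\<rho> / R) * z"
        have w: "w \<in> ball 0 1" unfolding w_def using inball z by simp
        have cw: "cmod w = \<rho>" and Iw: "Im w = \<rho> / R * Im z"
          using z R \<rho> by (auto simp: w_def norm_mult norm_divide)
        have "\<bar>Im z\<bar> = R / \<rho> * (2 / pi) * (pi / 2 * \<bar>Im w\<bar>)"
          using R \<rho> by (simp add: Iw abs_mult)
        also have "\<dots> \<le> R / \<rho> * (2 / pi) * (Re (k w) + (1 - \<rho>\<^sup>2) / 2)"
        proof (rule mult_left_mono)
          show "pi / 2 * \<bar>Im w\<bar> \<le> Re (k w) + (1 - \<rho>\<^sup>2) / 2"
            using Rek[OF w] unfolding cw by linarith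
        qed (use R \<rho> in auto)
        also have "\<dots> = Re (G z)" unfolding G_def w_def[symmetric] by simp
        finally show ?thesis .
      qed
      have "cmod (H z) = cmod (F z) * exp (- (a * Re (G z)))"
        unfolding H_def norm_mult prod Fq by simp
      also have "\<dots> \<le> cmod (F z) * exp (- (a * \<bar>Im z\<bar>))"
        using ReG a by (intro mult_left_mono) (auto intro: mult_left_mono)
      also have "\<dots> \<le> (C * exp (a * \<bar>Im z\<bar>)) * exp (- (a * \<bar>Im z\<bar>))"
        using bound[OF z] by (intro mult_right_mono) auto
      also have "\<dots> = C" by (simp add: exp_minus)
      finally show "cmod (H z) \<le> C" .
    qed auto
    moreover have "cmod (H 0) = cmod (q 0) * R ^ card S * exp (- (a * (R / \<rho> * (2 / pi) * (1 + (1 - \<rho>\<^sup>2) / 2))))"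
    proof -
      have "G 0 = of_real (R / \<rho> * (2 / pi) * (1 + (1 - \<rho>\<^sup>2) / 2))"
        by (simp add: G_def k)
      moreover have "(of_real (R\<^sup>2) :: complex) / of_real R = of_real R"
        using R by (simp add: power2_eq_square)
      ultimately show ?thesis
        using R by (simp add: H_def norm_mult norm_power)
    qed
    moreover have "cmod (F 0) * (\<Prod>s\<in>S. R / cmod s) = cmod (q 0) * R ^ card S"
    proof -
      have "(\<Prod>s\<in>S. R / cmod s) = R ^ card S / (\<Prod>s\<in>S. cmod s)"
        by (simp add: prod_dividef)
      moreover have "(\<Prod>s\<in>S. cmod s) \<noteq> 0"
        using S by (auto simp: prod_zero_iff)
      ultimately show ?thesis
        by (simp add: Fq norm_mult flip: prod_norm)
    qed
    ultimately show ?thesis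
      by (simp add: exp_minus field_simps)
  qed
  have "((\<lambda>\<rho>. C * exp (a * (R / \<rho> * (2 / pi) * (1 + (1 - \<rho>\<^sup>2) / 2)))) \<longlongrightarrow>
          C * exp (a * (R / 1 * (2 / pi) * (1 + (1 - 1\<^sup>2) / 2)))) (at_left 1)"
    by (intro tendsto_intros) auto
  moreover have "eventually (\<lambda>\<rho>. cmod (F 0) * (\<Prod>s\<in>S. R / cmod s)
      \<le> C * exp (a * (R / \<rho> * (2 / pi) * (1 + (1 - \<rho>\<^sup>2) / 2)))) (at_left 1)"
    using eventually_at_left_real[of 0 "1::real", OF zero_less_one]
    by eventually_elim (rule main, auto)
  ultimately have "cmod (F 0) * (\<Prod>s\<in>S. R / cmod s)
      \<le> C * exp (a * (R / 1 * (2 / pi) * (1 + (1 - 1\<^sup>2) / 2)))"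
    by (intro tendsto_lowerbound) auto
  then show ?thesis by (simp add: mult.commute mult.left_commute)
qed


text \<open>
  Suppose \<open>F 0 \<noteq> 0\<close>, and let \<open>\<Phi> n\<close> be the sum of \<open>ln (n / \<bar>s\<bar>)\<close> over the zeros \<open>s\<close> in \<open>[- n, n]\<close>.
  The step from \<open>n\<close> to \<open>n + 1\<close> raises each of the at least \<open>2 D n\<close> summands by
  \<open>ln ((n + 1) / n) \<ge> 1 / (n + 1)\<close>, so \<open>\<Phi>\<close> has asymptotic slope at least \<open>2 D\<close>. Jensen's inequality
  bounds that slope by \<open>2 a / \<pi> < 2 D\<close>.
\<close>

lemma entire_zero_at_origin_if_dense_zeros:
  fixes F :: "complex \<Rightarrow> complex" and Z :: "real set"
  assumes F: "F holomorphic_on UNIV" and a: "a \<ge> 0"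
    and bound: "\<And>z. cmod (F z) \<le> C * exp (a * \<bar>Im z\<bar>)"
    and Z: "\<And>s. s \<in> Z \<Longrightarrow> F (of_real s) = 0"
    and many: "\<And>r. r \<ge> r0 \<Longrightarrow> real (card (Z \<inter> {-r..r})) \<ge> 2 * D * r"
    and D: "pi * D > a"
  shows "F 0 = 0"
proof (rule ccontr)
  assume F0: "F 0 \<noteq> 0"
  have "a / pi < D" using D by (simp add: field_simps)
  \<comment> \<open>A slope strictly between the two, to absorb the factor \<open>n / (n + 1)\<close>.\<close>
  then obtain D1 where D1: "a / pi < D1" "D1 < D" using dense by blast
  have Dpos: "D > 0" "D1 > 0" using D1 a by (smt (verit) divide_nonneg_pos pi_gt_zero)+
  have "(\<lambda>n. real n / real (n + 1)) \<longlonglongrightarrow> 1"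
    by real_asymp
  then have "(\<lambda>n. D * (real n / real (n + 1))) \<longlonglongrightarrow> D * 1"
    by (intro tendsto_mult tendsto_const)
  then have "eventually (\<lambda>n. D * (real n / real (n + 1)) > D1) sequentially"
    using D1 by (intro order_tendstoD) auto
  moreover have "eventually (\<lambda>n. real n \<ge> r0 \<and> n \<ge> 1) sequentially"
    by (intro eventually_conj eventually_ge_at_top
      eventually_compose_filterlim[OF eventually_ge_at_top filterlim_real_sequentially])
  ultimately obtain N where N: "\<And>n. n \<ge> N \<Longrightarrow> D * (real n / real (n + 1)) > D1 \<and> real n \<ge> r0 \<and> n \<ge> 1"
    unfolding eventually_sequentially by (metis (no_types, lifting) linorder_le_cases order_trans)
  define S where "S = (\<lambda>n::nat. Z \<inter> {-real n..real n})"
  define \<Phi> where "\<Phi> = (\<lambda>n::nat. \<Sum>s\<in>S n. ln (real n / \<bar>s\<bar>))"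
  have card: "real (card (S n)) \<ge> 2 * D * real n" if "n \<ge> N" for n
    using many[of "real n"] N[OF that] by (simp add: S_def)
  have fin: "finite (S n)" if "n \<ge> N" for n
  proof (rule card_ge_0_finite)
    have "0 < 2 * D * real n" using Dpos N[OF that] by simp
    then show "card (S n) > 0" using card[OF that] by linarith
  qed
  have nz: "s \<noteq> 0" if "s \<in> S n" for s n
    using that F0 Z[of 0] by (auto simp: S_def)
  have ln_ratio_nonneg: "ln (real n / \<bar>s\<bar>) \<ge> 0" if "s \<in> S n" for s n
  proof (rule ln_ge_zero)
    have "\<bar>s\<bar> \<le> real n" using that by (auto simp: S_def)
    then show "1 \<le> real n / \<bar>s\<bar>" using nz[OF that] by simp
  qed
  have low: "\<Phi> n \<ge> 2 * D1 * (real n - real N)" if "n \<ge> N" for n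
    using that
  proof (induction n rule: dec_induct)
    case base
    have "\<Phi> N \<ge> 0" unfolding \<Phi>_def
      by (intro sum_nonneg ln_ratio_nonneg)
    then show ?case by simp
  next
    case (step n)
    have n: "n \<ge> 1" "D1 < D * (real n / real (n + 1))" using N step by auto
    have sub: "S n \<subseteq> S (Suc n)" by (auto simp: S_def)
    have "ln (real n / real (n + 1)) \<le> real n / real (n + 1) - 1"
      using n by (intro ln_le_minus_one) auto
    also have "\<dots> = - (1 / real (n + 1))" by (simp add: field_simps)
    finally have ln1: "ln (real (n + 1)) - ln (real n) \<ge> 1 / real (n + 1)"
      using n by (simp add: ln_div)
    have "2 * D1 \<le> 2 * D * real n * (1 / real (n + 1))" using n by simp
    also have "\<dots> \<le> real (card (S n)) * (ln (real (n + 1)) - ln (real n))"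
      using card[of n] step ln1 Dpos by (intro mult_mono) auto
    also have "\<Phi> n + \<dots> = (\<Sum>s\<in>S n. ln (real n / \<bar>s\<bar>) + (ln (real (n + 1)) - ln (real n)))"
      by (simp add: \<Phi>_def sum.distrib)
    also have "\<dots> = (\<Sum>s\<in>S n. ln (real (Suc n) / \<bar>s\<bar>))"
      using nz n by (intro sum.cong) (auto simp: ln_div)
    also have "\<dots> \<le> \<Phi> (Suc n)"
      unfolding \<Phi>_def
    proof (rule sum_mono2)
      show "finite (S (Suc n))" using step.hyps by (intro fin) simp
      show "0 \<le> ln (real (Suc n) / \<bar>s\<bar>)" if "s \<in> S (Suc n) - S n" for s
        using that by (intro ln_ratio_nonneg) auto
    qed (rule sub)
    finally have "\<Phi> n + 2 * D1 \<le> \<Phi> (Suc n)" by simp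
    then show ?case using step.IH by (simp add: algebra_simps)
  qed
  have up: "\<Phi> n \<le> ln (C / cmod (F 0)) + 2 * (a / pi) * real n" if "n \<ge> N" for n
  proof -
    have n: "n \<ge> 1" using N that by auto
    have "cmod (F 0) > 0" using F0 by simp
    moreover have "cmod (F 0) \<le> C" using bound[of 0] by simp
    ultimately have C: "C > 0" by linarith
    let ?T = "of_real ` S n :: complex set"
    have "cmod (F 0) * (\<Prod>s\<in>?T. real n / cmod s) \<le> C * exp (2 * a * real n / pi)"
      using n fin[OF that] nz[of 0 n] Z bound a
      by (intro jensen_exponential_type[OF F]) (auto simp: S_def)
    moreover have "(\<Prod>s\<in>?T. real n / cmod s) = (\<Prod>s\<in>S n. real n / \<bar>s\<bar>)"
      by (subst prod.reindex) (auto simp: inj_on_def)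
    moreover have pos: "(\<Prod>s\<in>S n. real n / \<bar>s\<bar>) > 0"
      using n nz by (intro prod_pos) auto
    ultimately have "(\<Prod>s\<in>S n. real n / \<bar>s\<bar>) \<le> C / cmod (F 0) * exp (2 * a * real n / pi)"
      using F0 by (simp add: field_simps)
    then have "ln (\<Prod>s\<in>S n. real n / \<bar>s\<bar>) \<le> ln (C / cmod (F 0) * exp (2 * a * real n / pi))"
      using pos C F0 by (subst ln_le_cancel_iff) auto
    also have "\<dots> = ln (C / cmod (F 0)) + 2 * (a / pi) * real n"
      using C F0 by (subst ln_mult) auto
    also have "ln (\<Prod>s\<in>S n. real n / \<bar>s\<bar>) = \<Phi> n"
      unfolding \<Phi>_def using n nz fin[OF that] by (intro ln_prod) auto
    finally show ?thesis .
  qed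
  have "2 * (D1 - a / pi) * real n \<le> ln (C / cmod (F 0)) + 2 * D1 * real N" if "n \<ge> N" for n
    using low[OF that] up[OF that] by (simp add: algebra_simps)
  moreover have "filterlim (\<lambda>n. 2 * (D1 - a / pi) * real n) at_top sequentially"
    using D1 by (intro filterlim_tendsto_pos_mult_at_top[OF tendsto_const _ filterlim_real_sequentially]) auto
  then have "eventually (\<lambda>n. 2 * (D1 - a / pi) * real n > ln (C / cmod (F 0)) + 2 * D1 * real N) sequentially"
    by (simp add: filterlim_at_top_dense)
  then obtain M where "\<And>n. n \<ge> M \<Longrightarrow> 2 * (D1 - a / pi) * real n > ln (C / cmod (F 0)) + 2 * D1 * real N"
    by (auto simp: eventually_sequentially)
  from this[of "max M N"] show False
    using calculation[of "max M N"] by auto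
qed

section \<open>Fourier inversion in the Paley-Wiener space\<close>

lemma square_integrable_diff:
  assumes f: "square_integrable f" and g: "square_integrable g"
  shows "square_integrable (\<lambda>x. f x - g x)"
  unfolding square_integrable_def
proof
  have [measurable]: "f \<in> borel_measurable borel" "g \<in> borel_measurable borel"
    using f g by (auto simp: square_integrable_def)
  show "(\<lambda>x. f x - g x) \<in> borel_measurable lborel" by simp
  show "integrable lborel (\<lambda>x. (cmod (f x - g x))\<^sup>2)"
  proof (rule Bochner_Integration.integrable_bound)
    show "integrable lborel (\<lambda>x. 2 * (cmod (f x))\<^sup>2 + 2 * (cmod (g x))\<^sup>2)"
      using f g by (simp add: square_integrable_def)
    show "(\<lambda>x. (cmod (f x - g x))\<^sup>2) \<in> borel_measurable lborel" by simp
    have "(cmod (f x - g x))\<^sup>2 \<le> 2 * (cmod (f x))\<^sup>2 + 2 * (cmod (g x))\<^sup>2" for x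
    proof -
      have "(cmod (f x - g x))\<^sup>2 \<le> (cmod (f x) + cmod (g x))\<^sup>2"
        by (intro power_mono norm_triangle_ineq4) auto
      also have "\<dots> \<le> 2 * (cmod (f x))\<^sup>2 + 2 * (cmod (g x))\<^sup>2"
        using sum_squares_bound[of "cmod (f x)" "cmod (g x)"] by (simp add: power2_sum)
      finally show ?thesis .
    qed
    then show "AE x in lborel. norm ((cmod (f x - g x))\<^sup>2) \<le> norm (2 * (cmod (f x))\<^sup>2 + 2 * (cmod (g x))\<^sup>2)"
      by simp
  qed
qed

lemma integrable_mult_of_square_integrable:
  fixes f g :: "real \<Rightarrow> complex"
  assumes "square_integrable f" "square_integrable g"
  shows "integrable lborel (\<lambda>x. f x * g x)"
proof (rule Bochner_Integration.integrable_bound)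
  show "integrable lborel (\<lambda>x. (cmod (f x))\<^sup>2 + (cmod (g x))\<^sup>2)"
    using assms by (simp add: square_integrable_def)
  show "(\<lambda>x. f x * g x) \<in> borel_measurable lborel"
    using assms by (auto simp: square_integrable_def)
  have "cmod (f x) * cmod (g x) \<le> (cmod (f x))\<^sup>2 + (cmod (g x))\<^sup>2" for x
  proof -
    have "cmod (f x) * cmod (g x) \<ge> 0" by simp
    then show ?thesis
      using sum_squares_bound[of "cmod (f x)" "cmod (g x)"] by linarith
  qed
  then show "AE x in lborel. norm (f x * g x) \<le> norm ((cmod (f x))\<^sup>2 + (cmod (g x))\<^sup>2)"
    by (simp add: norm_mult)
qed

text \<open>
  The integral of \<open>(t \<bar>f\<bar> - \<bar>g\<bar>)\<^sup>2\<close> is a nonnegative quadratic polynomial in \<open>t\<close>; it is evaluated at its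
  minimum.
\<close>

lemma Cauchy_Schwarz_integral:
  fixes f g :: "real \<Rightarrow> complex"
  assumes f: "square_integrable f" and g: "square_integrable g"
  shows "(cmod (\<integral>x. f x * g x \<partial>lborel))\<^sup>2
      \<le> (\<integral>x. (cmod (f x))\<^sup>2 \<partial>lborel) * (\<integral>x. (cmod (g x))\<^sup>2 \<partial>lborel)"
proof -
  define A B I where "A = (\<integral>x. (cmod (f x))\<^sup>2 \<partial>lborel)" "B = (\<integral>x. (cmod (g x))\<^sup>2 \<partial>lborel)"
    "I = (\<integral>x. cmod (f x) * cmod (g x) \<partial>lborel)"
  have int: "integrable lborel (\<lambda>x. (cmod (f x))\<^sup>2)" "integrable lborel (\<lambda>x. (cmod (g x))\<^sup>2)"
    using f g by (auto simp: square_integrable_def)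
  have intfg: "integrable lborel (\<lambda>x. cmod (f x) * cmod (g x))"
    using integrable_norm[OF integrable_mult_of_square_integrable[OF f g]] by (simp add: norm_mult)
  have quad: "0 \<le> t\<^sup>2 * A - 2 * t * I + B" for t
  proof -
    have "0 \<le> (\<integral>x. (t * cmod (f x) - cmod (g x))\<^sup>2 \<partial>lborel)" by simp
    also have "\<dots> = (\<integral>x. t\<^sup>2 * (cmod (f x))\<^sup>2 - 2 * t * (cmod (f x) * cmod (g x)) + (cmod (g x))\<^sup>2 \<partial>lborel)"
      by (intro Bochner_Integration.integral_cong) (auto simp: power2_eq_square algebra_simps)
    also have "\<dots> = t\<^sup>2 * A - 2 * t * I + B"
      using int intfg by (simp add: A_B_I_def)
    finally show ?thesis .
  qed
  have A0: "A \<ge> 0" and I0: "I \<ge> 0" by (auto simp: A_B_I_def)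
  have "I\<^sup>2 \<le> A * B"
  proof (cases "A = 0")
    case True
    have "I = 0"
    proof (rule ccontr)
      assume "I \<noteq> 0"
      then show False using quad[of "(B + 1) / (2 * I)"] True by simp
    qed
    then show ?thesis using True by simp
  next
    case False
    then have "0 \<le> A * ((I / A)\<^sup>2 * A - 2 * (I / A) * I + B)"
      using quad[of "I / A"] A0 by (intro mult_nonneg_nonneg) auto
    also have "\<dots> = A * B - I\<^sup>2"
      using False by (simp add: field_simps power2_eq_square)
    finally show ?thesis by simp
  qed
  moreover have "cmod (\<integral>x. f x * g x \<partial>lborel) \<le> I"
    unfolding A_B_I_def using integral_norm_bound[of lborel "\<lambda>x. f x * g x"] by (simp add: norm_mult)
  ultimately show ?thesis
    unfolding A_B_I_def[symmetric] by (meson norm_ge_zero order_trans power_mono)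
qed

text \<open>
  This is the characteristic function of the standard normal distribution after the substitution
  \<open>x = sqrt (2 \<pi>) \<xi> / c\<close>.
\<close>

lemma gaussian_fourier_integral:
  fixes c u :: real
  assumes c: "c > 0"
  shows "integrable lborel (\<lambda>\<xi>. exp (- (pi * (\<xi> / c)\<^sup>2)))" (is ?int)
    and "(\<integral>\<xi>. cis (2 * pi * u * \<xi>) * of_real (exp (- (pi * (\<xi> / c)\<^sup>2))) \<partial>lborel)
       = of_real (c * exp (- (pi * (c * u)\<^sup>2)))" (is ?eq)
proof -
  define a where "a = sqrt (2 * pi) / c"
  have a: "a > 0" using c by (simp add: a_def)
  have dens: "std_normal_density (0 + a * \<xi>) = exp (- (pi * (\<xi> / c)\<^sup>2)) / sqrt (2 * pi)" for \<xi>
    by (simp add: std_normal_density_def a_def power_mult_distrib power_divide)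
  have "integrable lborel (\<lambda>\<xi>. std_normal_density (0 + a * \<xi>))"
    using a by (intro lborel_integrable_real_affine) auto
  then show ?int
    unfolding dens by (simp add: divide_inverse)
  define t where "t = sqrt (2 * pi) * u * c"
  have ta: "t * (a * \<xi>) = 2 * pi * u * \<xi>" for \<xi>
    using c by (simp add: t_def a_def field_simps)
  have "of_real (exp (- (t\<^sup>2) / 2)) = (\<integral>x. std_normal_density x *\<^sub>R iexp (t * x) \<partial>lborel)"
    unfolding char_std_normal_distribution[THEN fun_cong, symmetric] char_def
    by (subst integral_density) auto
  also have "\<dots> = a *\<^sub>R (\<integral>\<xi>. std_normal_density (0 + a * \<xi>) *\<^sub>R iexp (t * (0 + a * \<xi>)) \<partial>lborel)"
    using a by (subst lborel_integral_real_affine[of a _ 0]) auto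
  also have "(\<lambda>\<xi>. std_normal_density (0 + a * \<xi>) *\<^sub>R iexp (t * (0 + a * \<xi>)))
      = (\<lambda>\<xi>. (1 / sqrt (2 * pi)) *\<^sub>R (cis (2 * pi * u * \<xi>) * of_real (exp (- (pi * (\<xi> / c)\<^sup>2)))))"
    unfolding dens unfolding add_0 ta by (simp add: fun_eq_iff cis_conv_exp scaleR_conv_of_real)
  also have "a *\<^sub>R (\<integral>\<xi>. (1 / sqrt (2 * pi)) *\<^sub>R (cis (2 * pi * u * \<xi>) * of_real (exp (- (pi * (\<xi> / c)\<^sup>2)))) \<partial>lborel)
     = (1 / c) *\<^sub>R (\<integral>\<xi>. cis (2 * pi * u * \<xi>) * of_real (exp (- (pi * (\<xi> / c)\<^sup>2))) \<partial>lborel)"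
    by (simp add: a_def)
  finally have "(\<integral>\<xi>. cis (2 * pi * u * \<xi>) * of_real (exp (- (pi * (\<xi> / c)\<^sup>2))) \<partial>lborel)
      = c *\<^sub>R of_real (exp (- (t\<^sup>2) / 2))"
    using c by simp
  also have "(t\<^sup>2) / 2 = pi * (c * u)\<^sup>2"
    by (simp add: t_def power_mult_distrib)
  then have "- (t\<^sup>2) / 2 = - (pi * (c * u)\<^sup>2)" by simp
  finally show ?eq by (simp add: scaleR_conv_of_real)
qed

lemma fourier_multiplication_formula:
  fixes h \<psi> :: "real \<Rightarrow> complex"
  assumes h: "integrable lborel h" and \<psi>: "integrable lborel \<psi>"
  shows "(\<integral>\<xi>. fourier_transform h \<xi> * \<psi> \<xi> \<partial>lborel) = (\<integral>t. h t * fourier_transform \<psi> t \<partial>lborel)"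
proof -
  have [measurable]: "h \<in> borel_measurable borel" "\<psi> \<in> borel_measurable borel"
    using h \<psi> by auto
  define k where "k = (\<lambda>t \<xi>. h t * \<psi> \<xi> * cis (- (2 * pi * t * \<xi>)))"
  have [measurable]: "(\<lambda>(t,\<xi>). k t \<xi>) \<in> borel_measurable (lborel \<Otimes>\<^sub>M lborel)"
    unfolding k_def cis_conv_exp by measurable
  have cis_int: "integrable lborel (\<lambda>\<xi>. w \<xi> * cis (- (2 * pi * t * \<xi>)))"
    if "integrable lborel w" for t :: real and w :: "real \<Rightarrow> complex"
    using that
    by (rule Bochner_Integration.integrable_bound) (use that in \<open>auto simp: norm_mult cis_conv_exp\<close>)
  have "integrable (lborel \<Otimes>\<^sub>M lborel) (\<lambda>(t,\<xi>). k t \<xi>)"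
  proof (rule lborel_pair.Fubini_integrable)
    show "integrable lborel (\<lambda>t. \<integral>\<xi>. norm (case (t, \<xi>) of (t, \<xi>) \<Rightarrow> k t \<xi>) \<partial>lborel)"
      using h by (simp add: k_def norm_mult)
    show "AE t in lborel. integrable lborel (\<lambda>\<xi>. case (t, \<xi>) of (t, \<xi>) \<Rightarrow> k t \<xi>)"
      using cis_int[OF \<psi>] by (simp add: k_def mult.assoc)
  qed measurable
  then have "(\<integral>\<xi>. (\<integral>t. k t \<xi> \<partial>lborel) \<partial>lborel) = (\<integral>t. (\<integral>\<xi>. k t \<xi> \<partial>lborel) \<partial>lborel)"
    by (rule lborel_pair.Fubini_integral)
  moreover have "(\<integral>t. k t \<xi> \<partial>lborel) = fourier_transform h \<xi> * \<psi> \<xi>" for \<xi>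
  proof -
    have "(\<integral>t. k t \<xi> \<partial>lborel) = (\<integral>t. (h t * cis (- (2 * pi * t * \<xi>))) * \<psi> \<xi> \<partial>lborel)"
      by (simp add: k_def mult_ac)
    then show ?thesis by (simp add: fourier_transform_def)
  qed
  moreover have "(\<integral>\<xi>. k t \<xi> \<partial>lborel) = h t * fourier_transform \<psi> t" for t
  proof -
    have "(\<integral>\<xi>. k t \<xi> \<partial>lborel) = (\<integral>\<xi>. h t * (\<psi> \<xi> * cis (- (2 * pi * \<xi> * t))) \<partial>lborel)"
      by (simp add: k_def mult_ac)
    then show ?thesis by (simp add: fourier_transform_def)
  qed
  ultimately show ?thesis by simp
qed


lemma gaussian_mean:
  fixes c :: real
  assumes c: "c > 0"
  shows "(\<integral>\<xi>. exp (- (pi * (\<xi> / c)\<^sup>2)) \<partial>lborel) = c"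
proof -
  have "of_real (\<integral>\<xi>. exp (- (pi * (\<xi> / c)\<^sup>2)) \<partial>lborel)
      = (\<integral>\<xi>. cis (2 * pi * 0 * \<xi>) * of_real (exp (- (pi * (\<xi> / c)\<^sup>2))) \<partial>lborel)"
    by simp
  also have "\<dots> = of_real c"
    using gaussian_fourier_integral(2)[OF c, of 0] by simp
  finally show ?thesis by (simp only: of_real_eq_iff)
qed

lemma square_integrable_gaussian:
  fixes c s :: real
  assumes c: "c > 0"
  shows "square_integrable (\<lambda>\<xi>. cis (2 * pi * s * \<xi>) * of_real (exp (- (pi * (\<xi> / c)\<^sup>2))))"
proof -
  define c' where "c' = c / sqrt 2"
  have c': "c' > 0" using c by (simp add: c'_def)
  have "(exp (- (pi * (\<xi> / c)\<^sup>2)))\<^sup>2 = exp (- (pi * (\<xi> / c')\<^sup>2))" for \<xi>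
    using c by (simp add: c'_def power_divide power_mult_distrib flip: exp_double)
  then show ?thesis
    using gaussian_fourier_integral(1)[OF c']
    by (simp add: square_integrable_def norm_mult cis_conv_exp)
qed

lemma square_integrable_shifted_gaussian:
  fixes c s :: real
  assumes c: "c > 0"
  shows "square_integrable (\<lambda>t. of_real (c * exp (- (pi * (c * (s - t))\<^sup>2))))"
proof -
  have "integrable lborel (\<lambda>\<xi>. (exp (- (pi * (\<xi> / (1 / c))\<^sup>2)))\<^sup>2)"
    using square_integrable_gaussian[of "1 / c" 0] c by (simp add: square_integrable_def)
  then have "integrable lborel (\<lambda>t. (exp (- (pi * ((s + (- 1) * t) / (1 / c))\<^sup>2)))\<^sup>2)"
    by (rule lborel_integrable_real_affine) simp
  then have "integrable lborel (\<lambda>t. c\<^sup>2 * (exp (- (pi * (c * (s - t))\<^sup>2)))\<^sup>2)"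
    by (simp add: mult.commute)
  moreover have "(cmod (of_real (c * exp (- (pi * (c * (s - t))\<^sup>2)))))\<^sup>2
      = c\<^sup>2 * (exp (- (pi * (c * (s - t))\<^sup>2)))\<^sup>2" for t
    by (simp only: norm_of_real power2_abs power_mult_distrib)
  ultimately show ?thesis
    by (simp only: square_integrable_def) simp
qed

lemma integrable_indicator_Icc_mult:
  fixes f :: "real \<Rightarrow> complex"
  assumes f: "square_integrable f"
  shows "integrable lborel (\<lambda>t. indicator {a..b} t * f t)"
proof -
  have "square_integrable (\<lambda>t. indicator {a..b} t)"
  proof -
    have "(cmod (indicator {a..b} t))\<^sup>2 = indicator {a..b} t" for t :: real
      by (auto simp: indicator_def)
    then show ?thesis by (simp add: square_integrable_def integrable_indicator_iff emeasure_lborel_Icc_eq)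
  qed
  from integrable_mult_of_square_integrable[OF this f] show ?thesis .
qed

text \<open>
  A Gaussian and its transform are both square integrable. Hence, in the multiplication formula
  for the truncations of \<open>f\<close> to \<open>[- R, R]\<close>, both sides converge as \<open>R \<rightarrow> \<infinity>\<close>: the left side because the
  truncated transforms tend to \<open>g\<close> in \<open>L\<^sup>2\<close>, the right side by dominated convergence. The result
  relates \<open>f\<close> to \<open>g\<close> through absolutely convergent integrals.
\<close>

lemma gaussian_weighted_inversion:
  fixes f g :: "real \<Rightarrow> complex"
  assumes fg: "has_L2_fourier_transform f g" and c: "c > 0"
  shows "(\<integral>\<xi>. g \<xi> * (cis (2 * pi * s * \<xi>) * of_real (exp (- (pi * (\<xi> / c)\<^sup>2)))) \<partial>lborel)
       = (\<integral>t. f t * of_real (c * exp (- (pi * (c * (s - t))\<^sup>2))) \<partial>lborel)"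
proof -
  define \<psi> where "\<psi> = (\<lambda>\<xi>. cis (2 * pi * s * \<xi>) * complex_of_real (exp (- (pi * (\<xi> / c)\<^sup>2))))"
  define K where "K = (\<lambda>t. complex_of_real (c * exp (- (pi * (c * (s - t))\<^sup>2))))"
  define fR where "fR = (\<lambda>R t. indicator {-R..R::real} t * f t)"
  have f: "square_integrable f" and g: "square_integrable g"
    and lim: "((\<lambda>R. \<integral>\<^sup>+\<xi>. ennreal ((cmod (fourier_transform (fR R) \<xi> - g \<xi>))\<^sup>2) \<partial>lborel) \<longlongrightarrow> 0) at_top"
    using fg by (auto simp: has_L2_fourier_transform_def fR_def)
  have [measurable]: "f \<in> borel_measurable borel" "g \<in> borel_measurable borel"
    using f g by (auto simp: square_integrable_def)
  have \<psi>2: "square_integrable \<psi>" and K2: "square_integrable K"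
    unfolding \<psi>_def K_def
    using c by (rule square_integrable_gaussian square_integrable_shifted_gaussian)+
  have \<psi>1: "integrable lborel \<psi>"
  proof (rule Bochner_Integration.integrable_bound[OF gaussian_fourier_integral(1)[OF c]])
    show "\<psi> \<in> borel_measurable lborel" using \<psi>2 by (simp add: square_integrable_def)
  qed (simp add: \<psi>_def norm_mult)
  have ft\<psi>: "fourier_transform \<psi> = K"
  proof
    fix t
    have "fourier_transform \<psi> t
        = (\<integral>\<xi>. cis (2 * pi * (s - t) * \<xi>) * of_real (exp (- (pi * (\<xi> / c)\<^sup>2))) \<partial>lborel)"
      unfolding fourier_transform_def \<psi>_def
    proof (intro Bochner_Integration.integral_cong refl)
      fix \<xi>
      have "cis (2 * pi * (s - t) * \<xi>) = cis (2 * pi * s * \<xi>) * cis (- (2 * pi * \<xi> * t))"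
        by (simp add: cis_mult algebra_simps)
      then show "cis (2 * pi * s * \<xi>) * of_real (exp (- (pi * (\<xi> / c)\<^sup>2))) * cis (- (2 * pi * \<xi> * t))
          = cis (2 * pi * (s - t) * \<xi>) * of_real (exp (- (pi * (\<xi> / c)\<^sup>2)))"
        by (simp only: mult_ac)
    qed
    also have "\<dots> = K t"
      unfolding K_def by (rule gaussian_fourier_integral(2)[OF c])
    finally show "fourier_transform \<psi> t = K t" .
  qed
  have fR1: "integrable lborel (fR R)" for R
    unfolding fR_def by (rule integrable_indicator_Icc_mult[OF f])
  have meas_ft[measurable]: "fourier_transform (fR R) \<in> borel_measurable borel" for R
    unfolding fourier_transform_def fR_def cis_conv_exp by measurable
  have pair: "(\<integral>\<xi>. fourier_transform (fR R) \<xi> * \<psi> \<xi> \<partial>lborel) = (\<integral>t. fR R t * K t \<partial>lborel)" for R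
    using fourier_multiplication_formula[OF fR1 \<psi>1] by (simp add: ft\<psi>)
  have limK: "((\<lambda>R. \<integral>t. fR R t * K t \<partial>lborel) \<longlongrightarrow> (\<integral>t. f t * K t \<partial>lborel)) at_top"
  proof (rule integral_dominated_convergence_at_top[where w="\<lambda>t. norm (f t * K t)"])
    show "integrable lborel (\<lambda>t. norm (f t * K t))"
      by (intro integrable_norm integrable_mult_of_square_integrable f K2)
    show "(\<lambda>t. f t * K t) \<in> borel_measurable lborel" "(\<lambda>t. fR R t * K t) \<in> borel_measurable lborel" for R
      using K2 by (auto simp: square_integrable_def fR_def)
    show "\<forall>\<^sub>F R in at_top. AE t in lborel. norm (fR R t * K t) \<le> norm (f t * K t)"
      by (intro always_eventually) (auto simp: fR_def norm_mult indicator_def)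
    show "AE t in lborel. ((\<lambda>R. fR R t * K t) \<longlongrightarrow> f t * K t) at_top"
    proof (rule AE_I2)
      fix t
      have "eventually (\<lambda>R. fR R t * K t = f t * K t) at_top"
        using eventually_ge_at_top[of "\<bar>t\<bar>"]
        by eventually_elim (auto simp: fR_def indicator_def)
      then show "((\<lambda>R. fR R t * K t) \<longlongrightarrow> f t * K t) at_top"
        by (simp add: tendsto_eventually)
    qed
  qed
  have lim\<psi>: "((\<lambda>R. \<integral>\<xi>. fourier_transform (fR R) \<xi> * \<psi> \<xi> \<partial>lborel) \<longlongrightarrow> (\<integral>\<xi>. g \<xi> * \<psi> \<xi> \<partial>lborel)) at_top"
  proof -
    define E where "E = (\<lambda>R. \<integral>\<^sup>+\<xi>. ennreal ((cmod (fourier_transform (fR R) \<xi> - g \<xi>))\<^sup>2) \<partial>lborel)"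
    define B where "B = (\<integral>\<xi>. (cmod (\<psi> \<xi>))\<^sup>2 \<partial>lborel)"
    have E0: "((\<lambda>R. enn2real (E R) * B) \<longlongrightarrow> 0 * B) at_top"
    proof (intro tendsto_mult tendsto_const)
      show "((\<lambda>R. enn2real (E R)) \<longlongrightarrow> 0) at_top"
        using tendsto_enn2real[of E 0 at_top] lim by (simp add: E_def)
    qed
    \<comment> \<open>Finiteness of \<open>E R\<close> is what makes the difference square integrable.\<close>
    have "eventually (\<lambda>R. E R < 1) at_top"
      using lim by (intro order_tendstoD) (auto simp: E_def)
    then have bound: "eventually (\<lambda>R. (cmod ((\<integral>\<xi>. fourier_transform (fR R) \<xi> * \<psi> \<xi> \<partial>lborel)
        - (\<integral>\<xi>. g \<xi> * \<psi> \<xi> \<partial>lborel)))\<^sup>2 \<le> enn2real (E R) * B) at_top"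
    proof eventually_elim
      case (elim R)
      define d where "d = (\<lambda>\<xi>. fourier_transform (fR R) \<xi> - g \<xi>)"
      have [measurable]: "d \<in> borel_measurable borel" unfolding d_def by measurable
      have "integrable lborel (\<lambda>\<xi>. (cmod (d \<xi>))\<^sup>2)"
        using elim by (intro integrableI_bounded) (auto simp: E_def d_def intro: less_trans)
      then have d2: "square_integrable d"
        by (simp add: square_integrable_def)
      have nn: "(\<integral>\<xi>. (cmod (d \<xi>))\<^sup>2 \<partial>lborel) = enn2real (E R)"
        by (subst integral_eq_nn_integral) (auto simp: E_def d_def)
      have "integrable lborel (\<lambda>\<xi>. d \<xi> * \<psi> \<xi>)" "integrable lborel (\<lambda>\<xi>. g \<xi> * \<psi> \<xi>)"
        by (intro integrable_mult_of_square_integrable d2 g \<psi>2)+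
      from Bochner_Integration.integral_add[OF this]
      have "(\<integral>\<xi>. fourier_transform (fR R) \<xi> * \<psi> \<xi> \<partial>lborel) - (\<integral>\<xi>. g \<xi> * \<psi> \<xi> \<partial>lborel) = (\<integral>\<xi>. d \<xi> * \<psi> \<xi> \<partial>lborel)"
        by (simp add: d_def algebra_simps)
      then show ?case
        using Cauchy_Schwarz_integral[OF d2 \<psi>2] by (simp add: nn B_def)
    qed
    have "((\<lambda>R. (cmod ((\<integral>\<xi>. fourier_transform (fR R) \<xi> * \<psi> \<xi> \<partial>lborel)
        - (\<integral>\<xi>. g \<xi> * \<psi> \<xi> \<partial>lborel)))\<^sup>2) \<longlongrightarrow> 0) at_top"
      using E0 by (intro tendsto_sandwich[OF _ bound tendsto_const]) auto
    from tendsto_real_sqrt[OF this]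
    show ?thesis by (simp add: tendsto_norm_zero_iff Lim_null[symmetric])
  qed
  have "(\<integral>\<xi>. g \<xi> * \<psi> \<xi> \<partial>lborel) = (\<integral>t. f t * K t \<partial>lborel)"
    using lim\<psi> limK unfolding pair by (intro tendsto_unique[OF trivial_limit_at_top_linorder])
  then show ?thesis by (simp add: \<psi>_def K_def)
qed

text \<open>
  The function \<open>f\<close> need not be bounded a priori, so it is split at distance \<open>1\<close> from \<open>s\<close>. The near part
  is bounded by compactness, and dominated convergence applies after rescaling. For the far part
  the narrow Gaussian is at most a tiny multiple of one fixed Gaussian, against which \<open>f\<close> is
  integrable.
\<close>

lemma gaussian_approximate_identity:
  fixes f :: "real \<Rightarrow> complex"
  assumes cont: "continuous_on UNIV f" and f: "square_integrable f"
  shows "(\<lambda>n. \<integral>t. f t * of_real (real (Suc n) * exp (- (pi * (real (Suc n) * (s - t))\<^sup>2))) \<partial>lborel)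
           \<longlonglongrightarrow> f s"
proof -
  have [measurable]: "f \<in> borel_measurable borel"
    using f by (simp add: square_integrable_def)
  define K where "K = (\<lambda>c t. c * exp (- (pi * (c * (s - t))\<^sup>2)))"
  define f1 where "f1 = (\<lambda>t. indicator {s-1..s+1} t * f t)"
  define f2 where "f2 = (\<lambda>t. f t - f1 t)"
  have [measurable]: "f1 \<in> borel_measurable borel" "f2 \<in> borel_measurable borel"
    unfolding f2_def f1_def by measurable
  have bdd: "bounded (f ` {s-1..s+1})"
    by (intro compact_imp_bounded compact_continuous_image continuous_on_subset[OF cont]) auto
  then obtain B where B: "\<And>t. t \<in> {s-1..s+1} \<Longrightarrow> cmod (f t) \<le> B"
    unfolding bounded_iff by blast
  have B0: "B \<ge> 0" using order_trans[OF norm_ge_zero B[of s]] by simp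
  have f1B: "cmod (f1 t) \<le> B" for t
    using B[of t] B0 by (auto simp: f1_def indicator_def)
  have K2: "square_integrable (\<lambda>t. of_real (K c t))" if "c > 0" for c
    unfolding K_def using that by (rule square_integrable_shifted_gaussian)
  have intf: "integrable lborel (\<lambda>t. f t * of_real (K c t))" if "c > 0" for c
    by (intro integrable_mult_of_square_integrable f K2 that)
  have int1: "integrable lborel (\<lambda>t. f1 t * of_real (K c t))"
   and int2: "integrable lborel (\<lambda>t. f2 t * of_real (K c t))" if "c > 0" for c
  proof -
    have [measurable]: "(\<lambda>t. complex_of_real (K c t)) \<in> borel_measurable borel"
      unfolding K_def by measurable
    show "integrable lborel (\<lambda>t. f1 t * of_real (K c t))"
      by (rule Bochner_Integration.integrable_bound[OF intf[OF that]])
         (auto simp: f1_def norm_mult indicator_def)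
    show "integrable lborel (\<lambda>t. f2 t * of_real (K c t))"
      by (rule Bochner_Integration.integrable_bound[OF intf[OF that]])
         (auto simp: f1_def f2_def norm_mult indicator_def)
  qed
  have near: "(\<lambda>n. \<integral>t. f1 t * of_real (K (real (Suc n)) t) \<partial>lborel) \<longlonglongrightarrow> f s"
  proof -
    have subst: "(\<integral>t. f1 t * of_real (K c t) \<partial>lborel)
       = (\<integral>u. f1 (s + (1 / c) * u) * of_real (exp (- (pi * u\<^sup>2))) \<partial>lborel)" if "c > 0" for c
    proof -
      have "(\<integral>t. f1 t * of_real (K c t) \<partial>lborel)
          = \<bar>1 / c\<bar> *\<^sub>R (\<integral>u. f1 (s + (1 / c) * u) * of_real (K c (s + (1 / c) * u)) \<partial>lborel)"
        using that by (intro lborel_integral_real_affine) auto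
      also have "\<dots> = (\<integral>u. (1 / c) *\<^sub>R (f1 (s + (1 / c) * u) * of_real (K c (s + (1 / c) * u))) \<partial>lborel)"
        using that by simp
      also have "\<dots> = (\<integral>u. f1 (s + (1 / c) * u) * of_real (exp (- (pi * u\<^sup>2))) \<partial>lborel)"
        using that by (intro Bochner_Integration.integral_cong) (auto simp: K_def scaleR_conv_of_real)
      finally show ?thesis .
    qed
    have "(\<lambda>n. \<integral>u. f1 (s + (1 / real (Suc n)) * u) * of_real (exp (- (pi * u\<^sup>2))) \<partial>lborel)
        \<longlonglongrightarrow> (\<integral>u. f s * of_real (exp (- (pi * u\<^sup>2))) \<partial>lborel)"
    proof (rule integral_dominated_convergence[where w="\<lambda>u. B * exp (- (pi * u\<^sup>2))"])
      show "integrable lborel (\<lambda>u. B * exp (- (pi * u\<^sup>2)))"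
        using gaussian_fourier_integral(1)[of 1] by (intro integrable_mult_right) simp
      show "AE u in lborel. (\<lambda>n. f1 (s + (1 / real (Suc n)) * u) * of_real (exp (- (pi * u\<^sup>2))))
          \<longlonglongrightarrow> f s * of_real (exp (- (pi * u\<^sup>2)))"
      proof (intro AE_I2 tendsto_mult tendsto_const)
        fix u :: real
        have lim: "(\<lambda>n. s + (1 / real (Suc n)) * u) \<longlonglongrightarrow> s"
        proof -
          have "(\<lambda>n. s + inverse (real (Suc n)) * u) \<longlonglongrightarrow> s + 0 * u"
            by (intro tendsto_intros LIMSEQ_inverse_real_of_nat)
          then show ?thesis by (simp add: inverse_eq_divide)
        qed
        then have "(\<lambda>n. f (s + (1 / real (Suc n)) * u)) \<longlonglongrightarrow> f s"
          using cont by (intro isCont_tendsto_compose[of _ f]) (auto simp: continuous_on_eq_continuous_at)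
        moreover have "eventually (\<lambda>n. s + (1 / real (Suc n)) * u \<in> {s-1<..<s+1}) sequentially"
          by (intro topological_tendstoD[OF lim]) auto
        then have "eventually (\<lambda>n. f (s + (1 / real (Suc n)) * u) = f1 (s + (1 / real (Suc n)) * u)) sequentially"
          by eventually_elim (auto simp: f1_def indicator_def)
        ultimately show "(\<lambda>n. f1 (s + (1 / real (Suc n)) * u)) \<longlonglongrightarrow> f s"
          by (rule Lim_transform_eventually)
      qed
      show "AE u in lborel. norm (f1 (s + (1 / real (Suc n)) * u) * of_real (exp (- (pi * u\<^sup>2))))
          \<le> B * exp (- (pi * u\<^sup>2))" for n
        using f1B by (auto simp: norm_mult intro!: mult_right_mono)
    qed auto
    also have "(\<integral>u. f s * of_real (exp (- (pi * u\<^sup>2))) \<partial>lborel) = f s * of_real (\<integral>u. exp (- (pi * u\<^sup>2)) \<partial>lborel)"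
      by simp
    also have "\<dots> = f s" using gaussian_mean[of 1] by simp
    finally show ?thesis by (simp only: subst[OF of_nat_0_less_iff[THEN iffD2, OF zero_less_Suc]])
  qed
  have far: "(\<lambda>n. \<integral>t. f2 t * of_real (K (real (Suc n)) t) \<partial>lborel) \<longlonglongrightarrow> 0"
  proof (rule Lim_null_comparison)
    \<comment> \<open>The fixed Gaussian has parameter \<open>c0\<close> with \<open>c0\<^sup>2 = 1 / 2\<close>: if \<open>\<bar>s - t\<bar> \<ge> 1\<close> and \<open>c \<ge> 1\<close>, then
      \<open>c\<^sup>2 (s - t)\<^sup>2 \<ge> c\<^sup>2 / 2 + (s - t)\<^sup>2 / 2\<close>.\<close>
    define c0 where "c0 = 1 / sqrt 2"
    define M where "M = (\<integral>t. cmod (f2 t * of_real (K c0 t)) \<partial>lborel)"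
    have c0: "c0 > 0" by (simp add: c0_def)
    have Kle: "cmod (f2 t * of_real (K c t)) \<le> c * exp (- (pi * c\<^sup>2 / 2)) / c0 * cmod (f2 t * of_real (K c0 t))"
      if c: "c \<ge> 1" for c t
    proof (cases "t \<in> {s-1..s+1}")
      case True then show ?thesis by (simp add: f2_def f1_def)
    next
      case False
      then have "1 \<le> \<bar>s - t\<bar>" by auto
      then have u: "1 \<le> (s - t)\<^sup>2" by (simp add: abs_le_square_iff[of 1, simplified])
      have c2: "1 \<le> c\<^sup>2" using c by simp
      have "c\<^sup>2 / 2 + (c0 * (s - t))\<^sup>2 \<le> (c * (s - t))\<^sup>2"
      proof -
        define w where "w = (s - t)\<^sup>2"
        have "(c * (s - t))\<^sup>2 = c\<^sup>2 * w" "(c0 * (s - t))\<^sup>2 = w / 2"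
          by (simp_all add: w_def c0_def power_mult_distrib power_divide)
        moreover have "0 \<le> (2 * c\<^sup>2 - 1) * (w - 1) + (c\<^sup>2 - 1)"
          using u c2 unfolding w_def by (intro add_nonneg_nonneg mult_nonneg_nonneg) auto
        ultimately show ?thesis by (simp add: algebra_simps)
      qed
      then have "pi * (c\<^sup>2 / 2 + (c0 * (s - t))\<^sup>2) \<le> pi * (c * (s - t))\<^sup>2"
        by (intro mult_left_mono) auto
      then have "exp (- (pi * (c * (s - t))\<^sup>2)) \<le> exp (- (pi * c\<^sup>2 / 2)) * exp (- (pi * (c0 * (s - t))\<^sup>2))"
        by (simp add: algebra_simps flip: exp_add)
      then have "K c t \<le> c * exp (- (pi * c\<^sup>2 / 2)) / c0 * K c0 t"
        using c c0 by (simp add: K_def mult.assoc)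
      then have "cmod (f2 t) * K c t \<le> cmod (f2 t) * (c * exp (- (pi * c\<^sup>2 / 2)) / c0 * K c0 t)"
        by (intro mult_left_mono) auto
      moreover have "K c t \<ge> 0" "K c0 t \<ge> 0" using c c0 by (auto simp: K_def)
      ultimately show ?thesis by (simp add: norm_mult mult_ac)
    qed
    show "eventually (\<lambda>n. norm (\<integral>t. f2 t * of_real (K (real (Suc n)) t) \<partial>lborel)
        \<le> real (Suc n) * exp (- (pi * (real (Suc n))\<^sup>2 / 2)) / c0 * M) sequentially"
    proof (intro always_eventually allI)
      fix n
      define c where "c = real (Suc n)"
      have c: "c \<ge> 1" by (simp add: c_def)
      have "norm (\<integral>t. f2 t * of_real (K c t) \<partial>lborel) \<le> (\<integral>t. cmod (f2 t * of_real (K c t)) \<partial>lborel)"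
        by (rule integral_norm_bound)
      also have "\<dots> \<le> (\<integral>t. c * exp (- (pi * c\<^sup>2 / 2)) / c0 * cmod (f2 t * of_real (K c0 t)) \<partial>lborel)"
        using c c0 by (intro integral_mono integrable_norm int2 integrable_mult_right Kle) auto
      also have "\<dots> = c * exp (- (pi * c\<^sup>2 / 2)) / c0 * M" by (simp only: integral_mult_right_zero M_def)
      finally show "norm (\<integral>t. f2 t * of_real (K (real (Suc n)) t) \<partial>lborel)
        \<le> real (Suc n) * exp (- (pi * (real (Suc n))\<^sup>2 / 2)) / c0 * M" by (simp only: c_def)
    qed
    have "(\<lambda>n. real (Suc n) * exp (- (pi * (real (Suc n))\<^sup>2 / 2))) \<longlonglongrightarrow> 0"
      by real_asymp
    then have "(\<lambda>n. real (Suc n) * exp (- (pi * (real (Suc n))\<^sup>2 / 2)) / c0 * M) \<longlonglongrightarrow> 0 / c0 * M"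
      using c0 by (intro tendsto_intros) auto
    then show "(\<lambda>n. real (Suc n) * exp (- (pi * (real (Suc n))\<^sup>2 / 2)) / c0 * M) \<longlonglongrightarrow> 0" by simp
  qed
  have "(\<integral>t. f1 t * of_real (K (real (Suc n)) t) \<partial>lborel) + (\<integral>t. f2 t * of_real (K (real (Suc n)) t) \<partial>lborel)
      = (\<integral>t. f t * of_real (K (real (Suc n)) t) \<partial>lborel)" for n
    using Bochner_Integration.integral_add[OF int1 int2, of "real (Suc n)" "real (Suc n)"]
    by (simp add: f2_def algebra_simps)
  then show ?thesis
    using tendsto_add[OF near far] by (simp only: K_def add_0_right)
qed

text \<open>
  Fourier inversion with an integrable transform. Letting the Gaussian weight of
  \<open>gaussian_weighted_inversion\<close> tend to \<open>1\<close> gives the inversion integral on one side and, since its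
  transform is an approximate identity, the value \<open>f s\<close> on the other. The limit holds at every \<open>s\<close>
  because \<open>f\<close> is continuous.
\<close>

lemma paley_wiener_representation:
  assumes f: "f \<in> paley_wiener \<Omega>"
  shows "\<exists>g. square_integrable g \<and> integrable lborel g \<and>
    (\<forall>\<xi>. \<bar>\<xi>\<bar> > \<Omega>/2 \<longrightarrow> g \<xi> = 0) \<and>
    (\<forall>s. f s = (\<integral>\<xi>. g \<xi> * cis (2 * pi * s * \<xi>) \<partial>lborel))"
proof -
  from f obtain g0 where cont: "continuous_on UNIV f" and f2: "square_integrable f"
    and fg: "has_L2_fourier_transform f g0"
    and AE0: "AE \<xi> in lborel. \<xi> \<notin> {-\<Omega>/2..\<Omega>/2} \<longrightarrow> g0 \<xi> = 0"
    by (auto simp: paley_wiener_def)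
  have g02: "square_integrable g0" using fg by (simp add: has_L2_fourier_transform_def)
  define g where "g = (\<lambda>\<xi>. indicator {-\<Omega>/2..\<Omega>/2} \<xi> * g0 \<xi>)"
  have [measurable]: "g0 \<in> borel_measurable borel" using g02 by (simp add: square_integrable_def)
  have gm[measurable]: "g \<in> borel_measurable borel" unfolding g_def by measurable
  have AEg: "AE \<xi> in lborel. g0 \<xi> = g \<xi>"
    using AE0 by eventually_elim (auto simp: g_def indicator_def)
  have g1: "integrable lborel g"
    unfolding g_def by (rule integrable_indicator_Icc_mult[OF g02])
  have g2: "square_integrable g"
    unfolding square_integrable_def
  proof
    show "integrable lborel (\<lambda>t. (cmod (g t))\<^sup>2)"
      by (rule Bochner_Integration.integrable_bound[of _ "\<lambda>t. (cmod (g0 t))\<^sup>2"])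
         (use g02 in \<open>auto simp: g_def square_integrable_def norm_mult indicator_def\<close>)
  qed simp
  have "f s = (\<integral>\<xi>. g \<xi> * cis (2 * pi * s * \<xi>) \<partial>lborel)" for s
  proof (rule LIMSEQ_unique[OF gaussian_approximate_identity[OF cont f2]])
    define G where "G = (\<lambda>n \<xi>. exp (- (pi * (\<xi> / real (Suc n))\<^sup>2)))"
    have "(\<lambda>n. \<integral>\<xi>. g \<xi> * (cis (2 * pi * s * \<xi>) * of_real (G n \<xi>)) \<partial>lborel)
        \<longlonglongrightarrow> (\<integral>\<xi>. g \<xi> * cis (2 * pi * s * \<xi>) \<partial>lborel)"
    proof (rule integral_dominated_convergence[where w="\<lambda>\<xi>. norm (g \<xi>)"])
      show "AE \<xi> in lborel. (\<lambda>n. g \<xi> * (cis (2 * pi * s * \<xi>) * of_real (G n \<xi>))) \<longlonglongrightarrow> g \<xi> * cis (2 * pi * s * \<xi>)"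
      proof (rule AE_I2)
        fix \<xi>
        have "(\<lambda>n. \<xi> / real (Suc n)) \<longlonglongrightarrow> 0"
          by (rule LIMSEQ_Suc[OF lim_const_over_n])
        then have "(\<lambda>n. G n \<xi>) \<longlonglongrightarrow> exp (- (pi * 0\<^sup>2))"
          unfolding G_def by (intro tendsto_intros)
        then have "(\<lambda>n. G n \<xi>) \<longlonglongrightarrow> 1" by simp
        then have "(\<lambda>n. g \<xi> * (cis (2 * pi * s * \<xi>) * of_real (G n \<xi>))) \<longlonglongrightarrow> g \<xi> * (cis (2 * pi * s * \<xi>) * of_real 1)"
          by (intro tendsto_intros)
        then show "(\<lambda>n. g \<xi> * (cis (2 * pi * s * \<xi>) * of_real (G n \<xi>))) \<longlonglongrightarrow> g \<xi> * cis (2 * pi * s * \<xi>)"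
          by simp
      qed
      show "AE \<xi> in lborel. norm (g \<xi> * (cis (2 * pi * s * \<xi>) * of_real (G n \<xi>))) \<le> norm (g \<xi>)" for n
        by (auto simp: norm_mult G_def intro!: mult_left_le)
    qed (use g1 in \<open>auto simp: G_def cis_conv_exp\<close>)
    moreover have "(\<integral>\<xi>. g \<xi> * (cis (2 * pi * s * \<xi>) * of_real (G n \<xi>)) \<partial>lborel)
      = (\<integral>t. f t * of_real (real (Suc n) * exp (- (pi * (real (Suc n) * (s - t))\<^sup>2))) \<partial>lborel)" for n
    proof -
      have "(\<integral>\<xi>. g \<xi> * (cis (2 * pi * s * \<xi>) * of_real (G n \<xi>)) \<partial>lborel)
          = (\<integral>\<xi>. g0 \<xi> * (cis (2 * pi * s * \<xi>) * of_real (G n \<xi>)) \<partial>lborel)"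
        by (rule integral_cong_AE) (use AEg in \<open>auto simp: G_def cis_conv_exp\<close>)
      also have "\<dots> = (\<integral>t. f t * of_real (real (Suc n) * exp (- (pi * (real (Suc n) * (s - t))\<^sup>2))) \<partial>lborel)"
        unfolding G_def by (rule gaussian_weighted_inversion[OF fg]) simp
      finally show ?thesis .
    qed
    ultimately show "(\<lambda>n. \<integral>t. f t * of_real (real (Suc n) * exp (- (pi * (real (Suc n) * (s - t))\<^sup>2))) \<partial>lborel)
        \<longlonglongrightarrow> (\<integral>\<xi>. g \<xi> * cis (2 * pi * s * \<xi>) \<partial>lborel)" by simp
  qed
  moreover have "g \<xi> = 0" if "\<bar>\<xi>\<bar> > \<Omega>/2" for \<xi>
    using that by (auto simp: g_def indicator_def)
  ultimately show ?thesis using g1 g2 by blast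
qed

section \<open>Samples on a separated set\<close>

lemma uniformly_separatedE:
  assumes "uniformly_separated X"
  obtains \<delta> where "\<delta> > 0" "\<And>s t. s \<in> X \<Longrightarrow> t \<in> X \<Longrightarrow> s \<noteq> t \<Longrightarrow> \<delta> \<le> \<bar>s - t\<bar>"
proof -
  define I where "I = (INF (x, y)\<in>{(x, y). x \<in> X \<and> y \<in> X \<and> x \<noteq> y}. ennreal \<bar>x - y\<bar>)"
  have "0 < I" using assms by (simp add: uniformly_separated_def I_def)
  then obtain e where e: "0 < e" "e < I" using dense by blast
  then have "e < top" by (metis order_less_trans top.extremum_strict top.not_eq_extremum)
  then obtain \<delta> where \<delta>: "e = ennreal \<delta>" "\<delta> \<ge> 0" by (cases e) auto
  show ?thesis
  proof
    show "\<delta> > 0" using e \<delta> by simp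
    fix s t assume "s \<in> X" "t \<in> X" "s \<noteq> t"
    then have "I \<le> ennreal \<bar>s - t\<bar>"
      unfolding I_def by (intro INF_lower2[of "(s, t)"]) auto
    then have "ennreal \<delta> \<le> ennreal \<bar>s - t\<bar>" using e(2) \<delta>(1) by (metis less_imp_le order_trans)
    then show "\<delta> \<le> \<bar>s - t\<bar>" by simp
  qed
qed

text \<open>
  Points at mutual distance at least \<open>\<delta>\<close> lie in different cells of a grid of width \<open>\<delta>\<close>, so the cell
  numbers label them injectively by integers.
\<close>

lemma floor_inj_on_separated:
  fixes y \<delta> :: real
  assumes \<delta>: "\<delta> > 0" and sep: "\<And>s t. s \<in> X \<Longrightarrow> t \<in> X \<Longrightarrow> s \<noteq> t \<Longrightarrow> \<delta> \<le> \<bar>s - t\<bar>"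
  shows "inj_on (\<lambda>s. \<lfloor>(s - y) / \<delta>\<rfloor>) X"
proof (rule inj_onI, rule ccontr)
  fix s t assume s: "s \<in> X" and t: "t \<in> X" and eq: "\<lfloor>(s - y) / \<delta>\<rfloor> = \<lfloor>(t - y) / \<delta>\<rfloor>" and "s \<noteq> t"
  then have "\<delta> \<le> \<bar>s - t\<bar>" using sep by blast
  moreover have "\<bar>(s - y) / \<delta> - (t - y) / \<delta>\<bar> < 1" using eq by linarith
  then have "\<bar>(s - t) / \<delta>\<bar> < 1" by (simp add: diff_divide_distrib)
  then have "\<bar>s - t\<bar> < \<delta>" using \<delta> by (simp add: field_simps)
  ultimately show False by simp
qed

lemma finite_separated_Int_interval:
  fixes a b \<delta> :: real
  assumes \<delta>: "\<delta> > 0" and sep: "\<And>s t. s \<in> X \<Longrightarrow> t \<in> X \<Longrightarrow> s \<noteq> t \<Longrightarrow> \<delta> \<le> \<bar>s - t\<bar>"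
  shows "finite (X \<inter> {a..b})"
proof (rule finite_imageD)
  show "inj_on (\<lambda>s. \<lfloor>(s - 0) / \<delta>\<rfloor>) (X \<inter> {a..b})"
    by (rule floor_inj_on_separated) (use \<delta> sep in auto)
  have "(\<lambda>s. \<lfloor>(s - 0) / \<delta>\<rfloor>) ` (X \<inter> {a..b}) \<subseteq> {\<lfloor>a / \<delta>\<rfloor>..\<lfloor>b / \<delta>\<rfloor>}"
    using \<delta> by (auto intro!: floor_mono divide_right_mono)
  then show "finite ((\<lambda>s. \<lfloor>(s - 0) / \<delta>\<rfloor>) ` (X \<inter> {a..b}))"
    using finite_subset by blast
qed

lemma inverse_square_int_sum_bounded:
  obtains B where "\<And>N :: int set. finite N \<Longrightarrow> (\<Sum>n\<in>N. 1 / (1 + (real_of_int n)\<^sup>2)) \<le> B"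
proof -
  define h where "h = (\<lambda>m::nat. 1 / (1 + (real m)\<^sup>2))"
  have "summable (\<lambda>m. 1 / (real m)\<^sup>2)"
    using inverse_power_summable[of 2, where 'a=real] by (simp add: inverse_eq_divide)
  moreover have "h \<in> O(\<lambda>m. 1 / (real m)\<^sup>2)" unfolding h_def by real_asymp
  ultimately have summ: "summable h"
    by (intro summable_comparison_test_bigo[of "\<lambda>m. 1 / (real m)\<^sup>2" h]) simp_all
  have half: "(\<Sum>n\<in>N. 1 / (1 + (real_of_int n)\<^sup>2)) \<le> suminf h"
    if "finite N" "inj_on (\<lambda>n. nat \<bar>n\<bar>) N" for N
  proof -
    have "(\<Sum>n\<in>N. 1 / (1 + (real_of_int n)\<^sup>2)) = sum h ((\<lambda>n. nat \<bar>n\<bar>) ` N)"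
      by (subst sum.reindex[OF that(2)]) (simp add: h_def)
    also have "\<dots> \<le> suminf h"
      using summ that(1) by (intro sum_le_suminf) (auto simp: h_def)
    finally show ?thesis .
  qed
  have "(\<Sum>n\<in>N. 1 / (1 + (real_of_int n)\<^sup>2)) \<le> suminf h + suminf h" if "finite N" for N
  proof -
    have "N = (N \<inter> {0..}) \<union> (N \<inter> {..<0})" by auto
    then have "(\<Sum>n\<in>N. 1 / (1 + (real_of_int n)\<^sup>2))
       = (\<Sum>n\<in>N \<inter> {0..}. 1 / (1 + (real_of_int n)\<^sup>2)) + (\<Sum>n\<in>N \<inter> {..<0}. 1 / (1 + (real_of_int n)\<^sup>2))"
      using that by (subst sum.union_disjoint[symmetric]) auto
    also have "\<dots> \<le> suminf h + suminf h"
      using that by (intro add_mono half) (auto simp: inj_on_def)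
    finally show ?thesis .
  qed
  then show ?thesis using that by blast
qed

text \<open>
  If \<open>x k\<close> lies in the grid cell number \<open>n\<close>, counted from \<open>y\<close>, the Gaussian at \<open>y - x k\<close> is at most a
  constant times \<open>1 / (1 + n\<^sup>2)\<close>. Distinct points have distinct \<open>n\<close>, which makes the bound
  independent of \<open>y\<close>.
\<close>

lemma separated_gaussian_sum_bounded:
  fixes x :: "'i \<Rightarrow> real"
  assumes \<delta>: "\<delta> > 0" and sep: "\<And>j k. j \<noteq> k \<Longrightarrow> \<delta> \<le> \<bar>x j - x k\<bar>"
  shows "\<exists>B. \<forall>K y. finite K \<longrightarrow> (\<Sum>k\<in>K. exp (- (pi * (y - x k)\<^sup>2))) \<le> B"
proof -
  obtain B where B: "\<And>N :: int set. finite N \<Longrightarrow> (\<Sum>n\<in>N. 1 / (1 + (real_of_int n)\<^sup>2)) \<le> B"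
    by (rule inverse_square_int_sum_bounded) (rule that)
  have injx: "inj x" using sep \<delta> by (intro injI) (force simp: abs_if)
  \<comment> \<open>Chosen so that \<open>1 + u\<^sup>2 \<le> c (1 + \<pi> (\<delta> u)\<^sup>2)\<close> for all \<open>u\<close>.\<close>
  define c where "c = max 1 (1 / (pi * \<delta>\<^sup>2))"
  have "pi * \<delta>\<^sup>2 * (1 / (pi * \<delta>\<^sup>2)) \<le> pi * \<delta>\<^sup>2 * c"
    using \<delta> by (intro mult_left_mono) (auto simp: c_def)
  then have c: "c \<ge> 1" "c * (pi * \<delta>\<^sup>2) \<ge> 1" using \<delta> by (auto simp: c_def mult.commute)
  have "(\<Sum>k\<in>K. exp (- (pi * (y - x k)\<^sup>2))) \<le> 3 * c * B" if K: "finite K" for K y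
  proof -
    define n where "n = (\<lambda>k. \<lfloor>(x k - y) / \<delta>\<rfloor>)"
    have "inj_on (\<lambda>s. \<lfloor>(s - y) / \<delta>\<rfloor>) (range x)"
      using sep by (intro floor_inj_on_separated[OF \<delta>]) (metis rangeE)
    then have inj: "inj_on n K"
      using injx by (auto simp: n_def inj_on_def)
    have term_le: "exp (- (pi * (y - x k)\<^sup>2)) \<le> 3 * c * (1 / (1 + (real_of_int (n k))\<^sup>2))" for k
    proof -
      define u where "u = (x k - y) / \<delta>"
      define m where "m = real_of_int (n k)"
      have m: "m \<le> u" "u < m + 1" unfolding m_def n_def u_def by linarith+
      then have "\<bar>m\<bar> \<le> \<bar>u\<bar> + 1" by linarith
      then have "m\<^sup>2 \<le> (\<bar>u\<bar> + 1)\<^sup>2" using abs_le_square_iff[of m "\<bar>u\<bar> + 1"] by simp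
      also have "\<dots> \<le> 2 * u\<^sup>2 + 2"
        using sum_squares_bound[of "\<bar>u\<bar>" 1] by (simp add: power2_sum)
      also have "\<dots> \<le> 3 * u\<^sup>2 + 2"
        using mult_right_mono[of 2 3 "u\<^sup>2"] by simp
      finally have m2: "1 + m\<^sup>2 \<le> 3 * (1 + u\<^sup>2)" by simp
      have "1 + u\<^sup>2 \<le> c + (c * (pi * \<delta>\<^sup>2)) * u\<^sup>2"
        using c mult_right_mono[OF c(2), of "u\<^sup>2"] by simp
      also have "\<dots> = c * (1 + pi * (y - x k)\<^sup>2)"
        using \<delta> by (simp add: u_def power_divide field_simps power2_commute)
      also have "\<dots> \<le> c * exp (pi * (y - x k)\<^sup>2)"
        using c by (intro mult_left_mono exp_ge_add_one_self) auto
      finally have "1 + m\<^sup>2 \<le> 3 * c * exp (pi * (y - x k)\<^sup>2)" using m2 by simp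
      then show ?thesis
        unfolding m_def[symmetric] by (simp add: exp_minus field_simps add_pos_nonneg)
    qed
    have "(\<Sum>k\<in>K. exp (- (pi * (y - x k)\<^sup>2))) \<le> (\<Sum>k\<in>K. 3 * c * (1 / (1 + (real_of_int (n k))\<^sup>2)))"
      by (intro sum_mono term_le)
    also have "\<dots> = 3 * c * (\<Sum>i\<in>n ` K. 1 / (1 + (real_of_int i)\<^sup>2))"
      by (simp only: sum.reindex[OF inj] o_def sum_distrib_left)
    also have "\<dots> \<le> 3 * c * B"
      using K c by (intro mult_left_mono B) auto
    finally show ?thesis .
  qed
  then show ?thesis by blast
qed

text \<open>
  The Plancherel-Polya inequality, by duality. With \<open>F k\<close> the samples and \<open>S\<close> the sum of \<open>\<bar>F k\<bar>\<^sup>2\<close> over a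
  finite set, \<open>S\<close> is the integral of \<open>g\<close> against the exponential sum \<open>P\<close> with coefficients \<open>cnj (F k)\<close>.
  Since \<open>g\<close> has bounded support, a Gaussian weight may be moved from \<open>P\<close> to \<open>g\<close> before the
  Cauchy-Schwarz inequality is applied. The weighted square integral of \<open>P\<close> is then a quadratic form
  whose matrix has the entries \<open>exp (- \<pi> (x j - x k)\<^sup>2)\<close>; its row sums are bounded, so by Schur's
  test the form is at most \<open>B S\<close>. Thus \<open>S\<^sup>2 \<le> A B S\<close>, with constants that do not depend on the finite
  set.
\<close>

lemma bandlimited_samples_square_bounded:
  fixes g :: "real \<Rightarrow> complex" and x :: "'i \<Rightarrow> real"
  assumes g: "square_integrable g" and supp: "\<And>\<xi>. \<bar>\<xi>\<bar> > b \<Longrightarrow> g \<xi> = 0"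
    and \<delta>: "\<delta> > 0" and sep: "\<And>j k. j \<noteq> k \<Longrightarrow> \<delta> \<le> \<bar>x j - x k\<bar>"
  shows "\<exists>B. \<forall>K. finite K \<longrightarrow> (\<Sum>k\<in>K. (cmod (\<integral>\<xi>. g \<xi> * cis (2 * pi * x k * \<xi>) \<partial>lborel))\<^sup>2) \<le> B"
proof -
  obtain B where B: "\<And>K y. finite K \<Longrightarrow> (\<Sum>k\<in>K. exp (- (pi * (y - x k)\<^sup>2))) \<le> B"
    using separated_gaussian_sum_bounded[of \<delta> x, OF \<delta> sep] by blast
  have B0: "B \<ge> 0" using B[of "{}" 0] by simp
  have [measurable]: "g \<in> borel_measurable borel" using g by (simp add: square_integrable_def)
  define F where "F = (\<lambda>k. \<integral>\<xi>. g \<xi> * cis (2 * pi * x k * \<xi>) \<partial>lborel)"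
  define u where "u = (\<lambda>\<xi>. g \<xi> * of_real (exp (pi * \<xi>\<^sup>2 / 2)))"
  define A where "A = (\<integral>\<xi>. (cmod (u \<xi>))\<^sup>2 \<partial>lborel)"
  have A0: "A \<ge> 0" by (simp add: A_def)
  have u2: "square_integrable u"
    unfolding square_integrable_def
  proof
    show "integrable lborel (\<lambda>\<xi>. (cmod (u \<xi>))\<^sup>2)"
    proof (rule Bochner_Integration.integrable_bound)
      show "integrable lborel (\<lambda>\<xi>. (exp (pi * b\<^sup>2 / 2))\<^sup>2 * (cmod (g \<xi>))\<^sup>2)"
        using g by (simp add: square_integrable_def)
      show "AE \<xi> in lborel. norm ((cmod (u \<xi>))\<^sup>2) \<le> norm ((exp (pi * b\<^sup>2 / 2))\<^sup>2 * (cmod (g \<xi>))\<^sup>2)"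
      proof (rule AE_I2)
        fix \<xi>
        show "norm ((cmod (u \<xi>))\<^sup>2) \<le> norm ((exp (pi * b\<^sup>2 / 2))\<^sup>2 * (cmod (g \<xi>))\<^sup>2)"
        proof (cases "\<bar>\<xi>\<bar> > b")
          case True then show ?thesis by (simp add: u_def supp)
        next
          case False
          then have "\<xi>\<^sup>2 \<le> b\<^sup>2" by (simp add: abs_le_square_iff[symmetric])
          then show ?thesis
            by (simp add: u_def norm_mult power_mult_distrib mult.commute mult_left_mono power_mono)
        qed
      qed
    qed (simp add: u_def)
  qed (simp add: u_def)
  have int: "integrable lborel (\<lambda>\<xi>. g \<xi> * cis (2 * pi * y * \<xi>))" for y
  proof (rule Bochner_Integration.integrable_bound)
    have "indicator {-b..b} \<xi> * g \<xi> = g \<xi>" for \<xi>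
      using supp[of \<xi>] by (cases "\<bar>\<xi>\<bar> > b") (auto simp: indicator_def)
    then show "integrable lborel g"
      using integrable_indicator_Icc_mult[OF g, of "-b" b] by (simp only:)
  qed (auto simp: norm_mult cis_conv_exp)
  have "(\<Sum>k\<in>K. (cmod (F k))\<^sup>2) \<le> A * B" if K: "finite K" for K
  proof -
    define S where "S = (\<Sum>k\<in>K. (cmod (F k))\<^sup>2)"
    define c where "c = (\<lambda>k. cnj (F k))"
    have S0: "S \<ge> 0" unfolding S_def by (intro sum_nonneg) auto
    define v where "v = (\<lambda>\<xi>. (\<Sum>k\<in>K. c k * cis (2 * pi * x k * \<xi>)) * of_real (exp (- (pi * \<xi>\<^sup>2 / 2))))"
    define E where "E = (\<lambda>\<xi>. \<Sum>j\<in>K. \<Sum>k\<in>K. c j * cnj (c k) *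
        (cis (2 * pi * (x j - x k) * \<xi>) * of_real (exp (- (pi * (\<xi> / 1)\<^sup>2)))))"
    have cisE: "cis (2 * pi * (x j - x k) * \<xi>) = cis (2 * pi * x j * \<xi>) * cnj (cis (2 * pi * x k * \<xi>))"
      for j k \<xi> by (simp add: cis_cnj cis_mult algebra_simps)
    have vE: "of_real ((cmod (v \<xi>))\<^sup>2) = E \<xi>" for \<xi>
    proof -
      have "of_real ((cmod (v \<xi>))\<^sup>2) = v \<xi> * cnj (v \<xi>)" by (rule complex_norm_square)
      also have "\<dots> = (\<Sum>j\<in>K. c j * cis (2 * pi * x j * \<xi>)) * (\<Sum>k\<in>K. cnj (c k * cis (2 * pi * x k * \<xi>)))
          * of_real (exp (- (pi * \<xi>\<^sup>2 / 2)) * exp (- (pi * \<xi>\<^sup>2 / 2)))"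
        by (simp add: v_def mult_ac)
      also have "exp (- (pi * \<xi>\<^sup>2 / 2)) * exp (- (pi * \<xi>\<^sup>2 / 2)) = exp (- (pi * (\<xi> / 1)\<^sup>2))"
        by (simp flip: exp_add)
      finally show ?thesis
        unfolding E_def cisE sum_product sum_distrib_right
        by (simp add: sum_distrib_left mult_ac)
    qed
    have intE0: "integrable lborel (\<lambda>\<xi>. cis (2 * pi * y * \<xi>) * complex_of_real (exp (- (pi * (\<xi> / 1)\<^sup>2))))" for y
      by (rule Bochner_Integration.integrable_bound[OF gaussian_fourier_integral(1)[of 1]])
         (auto simp: norm_mult cis_conv_exp)
    have intE: "integrable lborel E"
      unfolding E_def by (intro Bochner_Integration.integrable_sum integrable_mult_right intE0)
    have "integrable lborel (\<lambda>\<xi>. Re (of_real ((cmod (v \<xi>))\<^sup>2)))"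
      unfolding vE by (rule integrable_Re[OF intE])
    then have v2: "square_integrable v"
      by (simp add: square_integrable_def v_def cis_conv_exp)
    have "(\<integral>\<xi>. (cmod (v \<xi>))\<^sup>2 \<partial>lborel) \<le> B * S"
    proof -
      define e where "e = (\<lambda>j k. exp (- (pi * (x j - x k)\<^sup>2)))"
      have sym: "e j k = e k j" for j k by (simp add: e_def power2_commute)
      have "complex_of_real (\<integral>\<xi>. (cmod (v \<xi>))\<^sup>2 \<partial>lborel) = (\<integral>\<xi>. E \<xi> \<partial>lborel)"
        unfolding vE[symmetric] by (simp only: integral_complex_of_real)
      also have "\<dots> = (\<Sum>j\<in>K. \<Sum>k\<in>K. c j * cnj (c k) * of_real (e j k))"
        unfolding E_def
        by (simp only: Bochner_Integration.integral_sum Bochner_Integration.integrable_sum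
            integrable_mult_right intE0 integral_mult_right_zero gaussian_fourier_integral(2)[of 1, OF zero_less_one])
           (simp add: e_def)
      finally have "(\<integral>\<xi>. (cmod (v \<xi>))\<^sup>2 \<partial>lborel) \<le> cmod (\<Sum>j\<in>K. \<Sum>k\<in>K. c j * cnj (c k) * of_real (e j k))"
        by (metis abs_ge_self norm_of_real)
      also have "\<dots> \<le> (\<Sum>j\<in>K. \<Sum>k\<in>K. cmod (F j) * cmod (F k) * e j k)"
        by (intro sum_norm_le) (simp add: norm_mult c_def e_def)
      \<comment> \<open>Schur test for a symmetric matrix: split the product by the inequality of the means.\<close>
      also have "\<dots> \<le> (\<Sum>j\<in>K. \<Sum>k\<in>K. ((cmod (F j))\<^sup>2 / 2 + (cmod (F k))\<^sup>2 / 2) * e j k)"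
      proof (intro sum_mono mult_right_mono)
        fix j k
        show "cmod (F j) * cmod (F k) \<le> (cmod (F j))\<^sup>2 / 2 + (cmod (F k))\<^sup>2 / 2"
          using sum_squares_bound[of "cmod (F j)" "cmod (F k)"] by (simp add: field_simps)
      qed (simp add: e_def)
      also have "\<dots> = (\<Sum>j\<in>K. \<Sum>k\<in>K. (cmod (F j))\<^sup>2 / 2 * e j k) + (\<Sum>j\<in>K. \<Sum>k\<in>K. (cmod (F k))\<^sup>2 / 2 * e j k)"
        by (simp only: sum.distrib distrib_right)
      also have "(\<Sum>j\<in>K. \<Sum>k\<in>K. (cmod (F k))\<^sup>2 / 2 * e j k) = (\<Sum>j\<in>K. \<Sum>k\<in>K. (cmod (F j))\<^sup>2 / 2 * e j k)"
        by (subst sum.swap) (simp only: sym)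
      also have "(\<Sum>j\<in>K. \<Sum>k\<in>K. (cmod (F j))\<^sup>2 / 2 * e j k) + (\<Sum>j\<in>K. \<Sum>k\<in>K. (cmod (F j))\<^sup>2 / 2 * e j k)
          = (\<Sum>j\<in>K. (cmod (F j))\<^sup>2 * (\<Sum>k\<in>K. e j k))"
        by (simp add: sum_distrib_right mult.commute flip: sum.distrib)
      also have "\<dots> \<le> (\<Sum>j\<in>K. (cmod (F j))\<^sup>2 * B)"
        using B[OF K] by (intro sum_mono mult_left_mono) (auto simp: e_def)
      also have "\<dots> = B * S" by (simp add: S_def sum_distrib_left mult.commute)
      finally show ?thesis .
    qed
    moreover have "complex_of_real S = (\<integral>\<xi>. u \<xi> * v \<xi> \<partial>lborel)"
    proof -
      have "complex_of_real S = (\<Sum>k\<in>K. c k * F k)"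
        unfolding S_def c_def of_real_sum complex_norm_square by (simp only: mult.commute)
      also have "\<dots> = (\<integral>\<xi>. (\<Sum>k\<in>K. c k * (g \<xi> * cis (2 * pi * x k * \<xi>))) \<partial>lborel)"
        by (simp add: F_def int)
      also have "\<dots> = (\<integral>\<xi>. u \<xi> * v \<xi> \<partial>lborel)"
      proof (intro Bochner_Integration.integral_cong refl)
        fix \<xi>
        have "u \<xi> * v \<xi> = g \<xi> * (\<Sum>k\<in>K. c k * cis (2 * pi * x k * \<xi>))
            * of_real (exp (pi * \<xi>\<^sup>2 / 2) * exp (- (pi * \<xi>\<^sup>2 / 2)))"
          by (simp add: u_def v_def mult_ac)
        also have "exp (pi * \<xi>\<^sup>2 / 2) * exp (- (pi * \<xi>\<^sup>2 / 2)) = 1" by (simp flip: exp_add)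
        finally show "(\<Sum>k\<in>K. c k * (g \<xi> * cis (2 * pi * x k * \<xi>))) = u \<xi> * v \<xi>"
          by (simp add: sum_distrib_left mult_ac)
      qed
      finally show ?thesis .
    qed
    then have "S\<^sup>2 = (cmod (\<integral>\<xi>. u \<xi> * v \<xi> \<partial>lborel))\<^sup>2" by (metis norm_of_real power2_abs)
    ultimately have "S\<^sup>2 \<le> A * (B * S)"
      using Cauchy_Schwarz_integral[OF u2 v2] A0 unfolding A_def
      by (metis (no_types, lifting) mult_left_mono order_trans)
    then have "S * S \<le> (A * B) * S" by (simp add: power2_eq_square mult.assoc)
    then have "S \<le> A * B"
      using S0 A0 B0 by (cases "S = 0") (auto simp: mult_le_cancel_right)
    then show ?thesis by (simp add: S_def)
  qed
  then show ?thesis unfolding F_def by blast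
qed

section \<open>Entire extension and uniqueness\<close>

text \<open>
  Expanding the exponential and integrating term by term, which the bounded support of \<open>g\<close> permits,
  gives a power series that converges everywhere.
\<close>

lemma bandlimited_entire_extension:
  fixes g :: "real \<Rightarrow> complex"
  assumes g: "integrable lborel g" and supp: "\<And>\<xi>. \<bar>\<xi>\<bar> > b \<Longrightarrow> g \<xi> = 0"
  shows "\<exists>F C. F holomorphic_on UNIV \<and>
    (\<forall>z. cmod (F z) \<le> C * exp (2 * pi * b * \<bar>Im z\<bar>)) \<and>
    (\<forall>s. F (of_real s) = (\<integral>\<xi>. g \<xi> * cis (2 * pi * s * \<xi>) \<partial>lborel))"
proof -
  have [measurable]: "g \<in> borel_measurable borel" using g by auto
  define F where "F = (\<lambda>z. \<integral>\<xi>. g \<xi> * exp (of_real (2 * pi * \<xi>) * \<i> * z) \<partial>lborel)"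
  define C where "C = (\<integral>\<xi>. cmod (g \<xi>) \<partial>lborel)"
  define a where "a = (\<lambda>n. \<integral>\<xi>. g \<xi> * (of_real (2 * pi * \<xi>) * \<i>) ^ n / fact n \<partial>lborel)"
  have term_bound: "cmod (g \<xi> * (of_real (2 * pi * \<xi>) * \<i> * z) ^ n / fact n)
      \<le> cmod (g \<xi>) * ((2 * pi * b * cmod z) ^ n / fact n)" for \<xi> n z
  proof (cases "\<bar>\<xi>\<bar> > b")
    case True then show ?thesis by (simp add: supp)
  next
    case False
    then have "2 * pi * \<bar>\<xi>\<bar> * cmod z \<le> 2 * pi * b * cmod z"
      by (intro mult_left_mono mult_right_mono) auto
    then have "(2 * pi * \<bar>\<xi>\<bar> * cmod z) ^ n / fact n \<le> (2 * pi * b * cmod z) ^ n / fact n"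
      by (intro divide_right_mono power_mono) auto
    then have "cmod (g \<xi>) * ((2 * pi * \<bar>\<xi>\<bar> * cmod z) ^ n / fact n)
        \<le> cmod (g \<xi>) * ((2 * pi * b * cmod z) ^ n / fact n)"
      by (intro mult_left_mono) auto
    then show ?thesis by (simp add: norm_mult norm_power norm_divide)
  qed
  have int: "integrable lborel (\<lambda>\<xi>. g \<xi> * (of_real (2 * pi * \<xi>) * \<i> * z) ^ n / fact n)" for n z
  proof (rule Bochner_Integration.integrable_bound)
    show "integrable lborel (\<lambda>\<xi>. cmod (g \<xi>) * ((2 * pi * b * cmod z) ^ n / fact n))"
      using g by (intro integrable_mult_left integrable_norm)
    show "AE \<xi> in lborel. norm (g \<xi> * (of_real (2 * pi * \<xi>) * \<i> * z) ^ n / fact n)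
        \<le> norm (cmod (g \<xi>) * ((2 * pi * b * cmod z) ^ n / fact n))"
      using term_bound by (intro AE_I2) (metis abs_ge_self order_trans real_norm_def)
  qed measurable
  have exps: "summable (\<lambda>n. (2 * pi * b * cmod z) ^ n / fact n)" for z
    using summable_exp_generic[of "2 * pi * b * cmod z"] by (simp add: divide_inverse mult.commute)
  have series: "(\<lambda>n. a n * (z - 0) ^ n) sums F z" for z
  proof -
    have "(\<lambda>n. \<integral>\<xi>. g \<xi> * (of_real (2 * pi * \<xi>) * \<i> * z) ^ n / fact n \<partial>lborel)
        sums (\<integral>\<xi>. (\<Sum>n. g \<xi> * (of_real (2 * pi * \<xi>) * \<i> * z) ^ n / fact n) \<partial>lborel)"
    proof (rule sums_integral[OF int])
      show "AE \<xi> in lborel. summable (\<lambda>n. norm (g \<xi> * (of_real (2 * pi * \<xi>) * \<i> * z) ^ n / fact n))"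
      proof (rule AE_I2)
        fix \<xi>
        show "summable (\<lambda>n. norm (g \<xi> * (of_real (2 * pi * \<xi>) * \<i> * z) ^ n / fact n))"
          by (rule summable_comparison_test'[OF summable_mult[OF exps[of z], of "cmod (g \<xi>)"]])
             (use term_bound[of \<xi> z] in simp)
      qed
      have "(\<integral>\<xi>. norm (g \<xi> * (of_real (2 * pi * \<xi>) * \<i> * z) ^ n / fact n) \<partial>lborel)
          \<le> C * ((2 * pi * b * cmod z) ^ n / fact n)" for n
      proof -
        have "(\<integral>\<xi>. norm (g \<xi> * (of_real (2 * pi * \<xi>) * \<i> * z) ^ n / fact n) \<partial>lborel)
            \<le> (\<integral>\<xi>. cmod (g \<xi>) * ((2 * pi * b * cmod z) ^ n / fact n) \<partial>lborel)"
          using g by (intro integral_mono term_bound integrable_norm int integrable_mult_left)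
        then show ?thesis by (simp only: integral_mult_left_zero C_def)
      qed
      then show "summable (\<lambda>n. \<integral>\<xi>. norm (g \<xi> * (of_real (2 * pi * \<xi>) * \<i> * z) ^ n / fact n) \<partial>lborel)"
        by (intro summable_comparison_test'[OF summable_mult[OF exps[of z], of C]]) simp
    qed
    also have "(\<lambda>n. \<integral>\<xi>. g \<xi> * (of_real (2 * pi * \<xi>) * \<i> * z) ^ n / fact n \<partial>lborel) = (\<lambda>n. a n * (z - 0) ^ n)"
    proof
      fix n
      have "(\<integral>\<xi>. g \<xi> * (of_real (2 * pi * \<xi>) * \<i> * z) ^ n / fact n \<partial>lborel)
          = (\<integral>\<xi>. (g \<xi> * (of_real (2 * pi * \<xi>) * \<i>) ^ n / fact n) * z ^ n \<partial>lborel)"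
        by (intro Bochner_Integration.integral_cong refl) (simp add: power_mult_distrib)
      then show "(\<integral>\<xi>. g \<xi> * (of_real (2 * pi * \<xi>) * \<i> * z) ^ n / fact n \<partial>lborel) = a n * (z - 0) ^ n"
        by (simp only: integral_mult_left_zero a_def diff_zero)
    qed
    also have "(\<integral>\<xi>. (\<Sum>n. g \<xi> * (of_real (2 * pi * \<xi>) * \<i> * z) ^ n / fact n) \<partial>lborel) = F z"
      unfolding F_def
    proof (intro Bochner_Integration.integral_cong refl)
      fix \<xi>
      have "(\<lambda>n. g \<xi> * ((of_real (2 * pi * \<xi>) * \<i> * z) ^ n /\<^sub>R fact n)) sums (g \<xi> * exp (of_real (2 * pi * \<xi>) * \<i> * z))"
        by (intro sums_mult exp_converges)
      then show "(\<Sum>n. g \<xi> * (of_real (2 * pi * \<xi>) * \<i> * z) ^ n / fact n) = g \<xi> * exp (of_real (2 * pi * \<xi>) * \<i> * z)"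
        by (simp add: sums_iff scaleR_conv_of_real divide_inverse mult_ac)
    qed
    finally show ?thesis .
  qed
  have hol: "F holomorphic_on UNIV"
  proof -
    have "F holomorphic_on ball 0 r" for r
      using series by (intro power_series_holomorphic) auto
    then have "F field_differentiable at z" for z
      using holomorphic_on_imp_differentiable_at[of F "ball 0 (cmod z + 1)" z] by simp
    then show ?thesis by (simp add: holomorphic_on_def)
  qed
  have bound: "cmod (F z) \<le> C * exp (2 * pi * b * \<bar>Im z\<bar>)" for z
  proof -
    have "cmod (g \<xi> * exp (of_real (2 * pi * \<xi>) * \<i> * z)) \<le> cmod (g \<xi>) * exp (2 * pi * b * \<bar>Im z\<bar>)" for \<xi>
    proof (cases "\<bar>\<xi>\<bar> > b")
      case True then show ?thesis by (simp add: supp)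
    next
      case False
      have "- (2 * pi * \<xi> * Im z) \<le> 2 * pi * (\<bar>\<xi>\<bar> * \<bar>Im z\<bar>)"
        using abs_ge_minus_self[of "2 * pi * \<xi> * Im z"] by (simp add: abs_mult mult.assoc)
      also have "\<dots> \<le> 2 * pi * (b * \<bar>Im z\<bar>)"
        using False by (intro mult_left_mono mult_right_mono) auto
      finally show ?thesis by (simp add: norm_mult mult_left_mono mult.assoc)
    qed
    then have "(\<integral>\<xi>. cmod (g \<xi> * exp (of_real (2 * pi * \<xi>) * \<i> * z)) \<partial>lborel)
        \<le> (\<integral>\<xi>. cmod (g \<xi>) * exp (2 * pi * b * \<bar>Im z\<bar>) \<partial>lborel)"
      using g by (intro integral_mono_AE' integrable_mult_left integrable_norm AE_I2) auto
    also have "\<dots> = C * exp (2 * pi * b * \<bar>Im z\<bar>)" by (simp only: integral_mult_left_zero C_def)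
    finally show ?thesis
      unfolding F_def by (rule order_trans[OF integral_norm_bound])
  qed
  have "F (of_real s) = (\<integral>\<xi>. g \<xi> * cis (2 * pi * s * \<xi>) \<partial>lborel)" for s
    unfolding F_def cis_conv_exp
    by (intro Bochner_Integration.integral_cong refl) (simp add: mult_ac)
  with hol bound show ?thesis by blast
qed

lemma lower_beurling_density_gt_imp_card:
  assumes \<Omega>: "\<Omega> \<ge> 0" and dens: "lower_beurling_density X > ennreal \<Omega>"
    and fin: "\<And>a b. finite (X \<inter> {a..b})"
  obtains D r0 where "D > \<Omega>" "\<And>r t. r \<ge> r0 \<Longrightarrow> real (card (X \<inter> {t - r..t + r})) \<ge> 2 * D * r"
proof -
  obtain y where y: "ennreal \<Omega> < y" "y < lower_beurling_density X"
    using dense[OF dens] by blast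
  then have "y < top" using top.not_eq_extremum by (metis order_less_trans top.extremum_strict)
  then obtain D where D: "y = ennreal D" "D \<ge> 0" by (cases y) auto
  have D\<Omega>: "D > \<Omega>" using y \<Omega> D by (simp add: ennreal_less_iff)
  have "eventually (\<lambda>r::real. (INF t::real.
       emeasure (count_space UNIV) (X \<inter> {t - r..t + r}) / ennreal (2 * r)) > y) at_top"
    using y(2) unfolding lower_beurling_density_def by (rule less_LiminfD)
  moreover have "eventually (\<lambda>r::real. r > 0) at_top" by (rule eventually_gt_at_top)
  ultimately have "eventually (\<lambda>r. \<forall>t. real (card (X \<inter> {t - r..t + r})) \<ge> 2 * D * r) at_top"
  proof eventually_elim
    case (elim r)
    show ?case
    proof
      fix t
      have "y < emeasure (count_space UNIV) (X \<inter> {t - r..t + r}) / ennreal (2 * r)"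
        using elim(1) by (rule less_INF_D) simp
      also have "\<dots> = ennreal (real (card (X \<inter> {t - r..t + r})) / (2 * r))"
        using fin elim(2) by (simp add: divide_ennreal ennreal_of_nat_eq_real_of_nat)
      finally have "D < real (card (X \<inter> {t - r..t + r})) / (2 * r)"
        using D by (simp add: ennreal_less_iff)
      then show "real (card (X \<inter> {t - r..t + r})) \<ge> 2 * D * r"
        using elim(2) by (simp add: field_simps)
    qed
  qed
  then obtain r0 where "\<And>r t. r \<ge> r0 \<Longrightarrow> real (card (X \<inter> {t - r..t + r})) \<ge> 2 * D * r"
    by (auto simp: eventually_at_top_linorder)
  with D\<Omega> that show ?thesis by blast
qed

text \<open>
  Around any centre \<open>t\<close> the zeros have the density needed for the translate \<open>z \<mapsto> F (z + t)\<close> to vanish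
  at the origin; here it matters that the lower Beurling density is uniform in the centre. The
  finite exceptional set \<open>T\<close> costs a bounded number of zeros, which is made up for by a slightly smaller
  density.
\<close>

lemma dense_real_zeros_imp_zero:
  fixes F :: "complex \<Rightarrow> complex" and X :: "real set"
  assumes F: "F holomorphic_on UNIV" and \<Omega>: "\<Omega> \<ge> 0"
    and bound: "\<And>z. cmod (F z) \<le> C * exp (pi * \<Omega> * \<bar>Im z\<bar>)"
    and dens: "lower_beurling_density X > ennreal \<Omega>"
    and fin: "\<And>a b. finite (X \<inter> {a..b})"
    and zeros: "finite T" "\<And>s. s \<in> X - T \<Longrightarrow> F (of_real s) = 0"
  shows "F (of_real t) = 0"
proof -
  obtain D r0 where D: "D > \<Omega>" and card: "\<And>r t. r \<ge> r0 \<Longrightarrow> real (card (X \<inter> {t - r..t + r})) \<ge> 2 * D * r"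
    using lower_beurling_density_gt_imp_card[OF \<Omega> dens fin] by blast
  define D' where "D' = (D + \<Omega>) / 2"
  have D': "D' > \<Omega>" "D' < D" using D by (auto simp: D'_def)
  \<comment> \<open>From this radius on, the missing \<open>card T\<close> zeros are covered by \<open>2 (D - D') r\<close>.\<close>
  define r1 where "r1 = max r0 (real (card T) / (2 * (D - D')))"
  define G where "G = (\<lambda>z. F (z + of_real t))"
  have "G 0 = 0"
  proof (rule entire_zero_at_origin_if_dense_zeros)
    have "F \<circ> (\<lambda>z. z + of_real t) holomorphic_on UNIV"
      by (intro holomorphic_on_compose holomorphic_intros holomorphic_on_subset[OF F]) auto
    then show "G holomorphic_on UNIV" by (simp add: G_def o_def)
    show "cmod (G z) \<le> C * exp (pi * \<Omega> * \<bar>Im z\<bar>)" for z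
      using bound[of "z + of_real t"] by (simp add: G_def)
    show "pi * \<Omega> \<ge> 0" "pi * D' > pi * \<Omega>" using \<Omega> D' by auto
    show "G (of_real s) = 0" if "s \<in> (\<lambda>s. s - t) ` (X - T)" for s
      using that zeros by (auto simp: G_def)
    fix r assume r: "r \<ge> r1"
    have "(\<lambda>s. s - t) ` (X - T) \<inter> {-r..r} = (\<lambda>s. s - t) ` ((X \<inter> {t - r..t + r}) - T)"
      by (auto simp: image_iff)
    then have "card ((\<lambda>s. s - t) ` (X - T) \<inter> {-r..r}) = card ((X \<inter> {t - r..t + r}) - T)"
      by (simp add: card_image)
    moreover have "card (X \<inter> {t - r..t + r}) - card T \<le> card ((X \<inter> {t - r..t + r}) - T)"
      using zeros(1) by (rule diff_card_le_card_Diff)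
    moreover have "real (card T) \<le> 2 * (D - D') * r"
      using r D' by (simp add: r1_def field_simps)
    moreover have "real (card (X \<inter> {t - r..t + r})) \<ge> 2 * D * r"
      using r by (intro card) (simp add: r1_def)
    ultimately show "2 * D' * r \<le> real (card ((\<lambda>s. s - t) ` (X - T) \<inter> {-r..r}))"
      by (simp add: algebra_simps)
  qed
  then show ?thesis by (simp add: G_def)
qed

section \<open>Folding\<close>

lemma real_folding_props:
  assumes "lam > 0"
  shows "real_folding lam u \<in> {-lam..<lam}"
    and "\<exists>n::int. u - real_folding lam u = 2 * lam * of_int n"
    and "\<bar>real_folding lam u\<bar> \<le> \<bar>u\<bar>"
proof -
  have *: "real_folding lam u \<in> {-lam..<lam} \<and> (\<exists>n::int. u - real_folding lam u = 2 * lam * of_int n)"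
    unfolding real_folding_def by (rule theI'[OF real_folding_unique[OF assms]])
  then show "real_folding lam u \<in> {-lam..<lam}"
    and "\<exists>n::int. u - real_folding lam u = 2 * lam * of_int n" by auto
  show "\<bar>real_folding lam u\<bar> \<le> \<bar>u\<bar>"
  proof (cases "u \<in> {-lam..<lam}")
    case True
    then have "u \<in> {-lam..<lam} \<and> (\<exists>n::int. u - u = 2 * lam * of_int n)" by (auto intro: exI[of _ 0])
    then have "real_folding lam u = u"
      using * real_folding_unique[OF assms, of u] by blast
    then show ?thesis by simp
  next
    case False
    then show ?thesis using * by auto
  qed
qed

lemma real_folding_eq_imp:
  assumes "lam > 0" "real_folding lam u = real_folding lam v"
  shows "u = v \<or> 2 * lam \<le> \<bar>u - v\<bar>"
proof -
  obtain m n :: int where "u - real_folding lam u = 2 * lam * of_int m"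
    "v - real_folding lam v = 2 * lam * of_int n"
    using real_folding_props(2)[OF assms(1)] by metis
  then have eq: "u - v = 2 * lam * of_int (m - n)"
    using assms(2) by (simp add: algebra_simps)
  show ?thesis
  proof (cases "m = n")
    case True then show ?thesis using eq by simp
  next
    case False
    then have "(1::real) \<le> \<bar>of_int (m - n)\<bar>" by linarith
    then have "2 * lam * 1 \<le> 2 * lam * \<bar>of_int (m - n)\<bar>" using assms(1) by (intro mult_left_mono) auto
    then show ?thesis unfolding eq using assms(1) by (simp add: abs_mult)
  qed
qed

theorem corollary2p3:
  fixes \<Omega> lam :: real and x :: "int \<Rightarrow> real"
  assumes "\<Omega> > 0" and "lam > 0"
    and "inj x"
    and "uniformly_separated (range x)"
    and "lower_beurling_density (range x) > ennreal \<Omega>"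
  shows "folded_sampling lam x \<in> paley_wiener \<Omega> \<rightarrow> folded_ell2 lam \<and>
    inj_on (folded_sampling lam x) (paley_wiener \<Omega>)"
proof -
  obtain \<delta> where \<delta>: "\<delta> > 0" and sepX: "\<And>s t. s \<in> range x \<Longrightarrow> t \<in> range x \<Longrightarrow> s \<noteq> t \<Longrightarrow> \<delta> \<le> \<bar>s - t\<bar>"
    using uniformly_separatedE[OF assms(4)] by blast
  have sep: "\<delta> \<le> \<bar>x j - x k\<bar>" if "j \<noteq> k" for j k
    using sepX[of "x j" "x k"] that \<open>inj x\<close> by (auto simp: inj_eq)
  have fold_le: "(cmod (folding lam z))\<^sup>2 \<le> (cmod z)\<^sup>2" for z
    using real_folding_props(3)[OF \<open>lam > 0\<close>]
    by (simp add: cmod_power2 folding_def add_mono abs_le_square_iff[symmetric])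
  have "folded_sampling lam x f \<in> folded_ell2 lam" if f: "f \<in> paley_wiener \<Omega>" for f
  proof -
    obtain g where g: "square_integrable g" and supp0: "\<forall>\<xi>. \<bar>\<xi>\<bar> > \<Omega>/2 \<longrightarrow> g \<xi> = 0"
      and fg: "\<forall>s. f s = (\<integral>\<xi>. g \<xi> * cis (2 * pi * s * \<xi>) \<partial>lborel)"
      using paley_wiener_representation[OF f] by blast
    have supp: "g \<xi> = 0" if "\<bar>\<xi>\<bar> > \<Omega> / 2" for \<xi>
      using that supp0 by blast
    have "\<exists>B. \<forall>K. finite K \<longrightarrow> (\<Sum>k\<in>K. (cmod (\<integral>\<xi>. g \<xi> * cis (2 * pi * x k * \<xi>) \<partial>lborel))\<^sup>2) \<le> B"
      using g supp \<delta> sep by (rule bandlimited_samples_square_bounded)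
    then obtain B where B: "\<And>K. finite K \<Longrightarrow> (\<Sum>k\<in>K. (cmod (f (x k)))\<^sup>2) \<le> B" using fg by auto
    have "(\<lambda>k. (cmod (folding lam (f (x k))))\<^sup>2) summable_on UNIV"
    proof (rule nonneg_bdd_above_summable_on)
      have "(\<Sum>k\<in>K. (cmod (folding lam (f (x k))))\<^sup>2) \<le> B" if "finite K" for K
        using sum_mono[of K "\<lambda>k. (cmod (folding lam (f (x k))))\<^sup>2" "\<lambda>k. (cmod (f (x k)))\<^sup>2"] fold_le B[OF that]
        by (meson order_trans)
      then show "bdd_above (sum (\<lambda>k. (cmod (folding lam (f (x k))))\<^sup>2) ` {F. F \<subseteq> UNIV \<and> finite F})"
        by (intro bdd_aboveI[of _ B]) auto
    qed simp
    then show ?thesis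
      using real_folding_props(1)[OF \<open>lam > 0\<close>]
      by (simp add: folded_ell2_def folded_sampling_def folding_def)
  qed
  moreover have "f1 = f2" if f: "f1 \<in> paley_wiener \<Omega>" "f2 \<in> paley_wiener \<Omega>"
    and eq: "folded_sampling lam x f1 = folded_sampling lam x f2" for f1 f2
  proof -
    obtain g1 where g1: "square_integrable g1" "integrable lborel g1"
      and supp1: "\<forall>\<xi>. \<bar>\<xi>\<bar> > \<Omega>/2 \<longrightarrow> g1 \<xi> = 0"
      and fg1: "\<forall>s. f1 s = (\<integral>\<xi>. g1 \<xi> * cis (2 * pi * s * \<xi>) \<partial>lborel)"
      using paley_wiener_representation[OF f(1)] by blast
    obtain g2 where g2: "square_integrable g2" "integrable lborel g2"
      and supp2: "\<forall>\<xi>. \<bar>\<xi>\<bar> > \<Omega>/2 \<longrightarrow> g2 \<xi> = 0"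
      and fg2: "\<forall>s. f2 s = (\<integral>\<xi>. g2 \<xi> * cis (2 * pi * s * \<xi>) \<partial>lborel)"
      using paley_wiener_representation[OF f(2)] by blast
    define g where "g = (\<lambda>\<xi>. g1 \<xi> - g2 \<xi>)"
    have g: "integrable lborel g" unfolding g_def using g1 g2 by simp
    have supp: "g \<xi> = 0" if "\<bar>\<xi>\<bar> > \<Omega> / 2" for \<xi>
      using that supp1 supp2 by (simp add: g_def)
    have gsq: "square_integrable g"
      unfolding g_def using g1(1) g2(1) by (rule square_integrable_diff)
    have intc: "integrable lborel (\<lambda>\<xi>. w \<xi> * cis (2 * pi * s * \<xi>))" if "integrable lborel w" for w s
      using that by (rule Bochner_Integration.integrable_bound) (use that in \<open>auto simp: norm_mult cis_conv_exp\<close>)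
    have h: "f1 s - f2 s = (\<integral>\<xi>. g \<xi> * cis (2 * pi * s * \<xi>) \<partial>lborel)" for s
      unfolding fg1[rule_format] fg2[rule_format] g_def left_diff_distrib
      using intc[OF g1(2)] intc[OF g2(2)] by simp
    from g supp have "\<exists>F C. F holomorphic_on UNIV \<and>
        (\<forall>z. cmod (F z) \<le> C * exp (2 * pi * (\<Omega> / 2) * \<bar>Im z\<bar>)) \<and>
        (\<forall>s. F (of_real s) = (\<integral>\<xi>. g \<xi> * cis (2 * pi * s * \<xi>) \<partial>lborel))"
      by (rule bandlimited_entire_extension)
    then obtain F C where F: "F holomorphic_on UNIV" "\<And>z. cmod (F z) \<le> C * exp (2 * pi * (\<Omega> / 2) * \<bar>Im z\<bar>)"
      and Fs: "\<And>s. F (of_real s) = (\<integral>\<xi>. g \<xi> * cis (2 * pi * s * \<xi>) \<partial>lborel)"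
      by blast
    have "\<exists>B. \<forall>K. finite K \<longrightarrow> (\<Sum>k\<in>K. (cmod (\<integral>\<xi>. g \<xi> * cis (2 * pi * x k * \<xi>) \<partial>lborel))\<^sup>2) \<le> B"
      using gsq supp \<delta> sep by (rule bandlimited_samples_square_bounded)
    then obtain B where B: "\<And>K. finite K \<Longrightarrow> (\<Sum>k\<in>K. (cmod (f1 (x k) - f2 (x k)))\<^sup>2) \<le> B" by (auto simp: h)
    define N where "N = {k. f1 (x k) \<noteq> f2 (x k)}"
    \<comment> \<open>A nonzero difference of samples with equal foldings has modulus at least \<open>2 lam\<close>; square
      summability allows only finitely many of them.\<close>
    have big: "(2 * lam)\<^sup>2 \<le> (cmod (f1 (x k) - f2 (x k)))\<^sup>2" if "k \<in> N" for k
    proof -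
      have fe: "real_folding lam (Re (f1 (x k))) = real_folding lam (Re (f2 (x k)))"
        "real_folding lam (Im (f1 (x k))) = real_folding lam (Im (f2 (x k)))"
        using fun_cong[OF eq, of k] by (auto simp: folded_sampling_def folding_def)
      have "Re (f1 (x k)) \<noteq> Re (f2 (x k)) \<or> Im (f1 (x k)) \<noteq> Im (f2 (x k))"
        using that by (auto simp: N_def complex_eq_iff)
      then have "2 * lam \<le> \<bar>Re (f1 (x k) - f2 (x k))\<bar> \<or> 2 * lam \<le> \<bar>Im (f1 (x k) - f2 (x k))\<bar>"
        using real_folding_eq_imp[OF \<open>lam > 0\<close> fe(1)] real_folding_eq_imp[OF \<open>lam > 0\<close> fe(2)] by auto
      then have "2 * lam \<le> cmod (f1 (x k) - f2 (x k))"
        using abs_Re_le_cmod abs_Im_le_cmod order_trans by blast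
      then show ?thesis using \<open>lam > 0\<close> by (intro power_mono) auto
    qed
    have "finite N"
    proof (rule ccontr)
      assume "infinite N"
      obtain n :: nat where n: "B / (2 * lam)\<^sup>2 < real n" using reals_Archimedean2 by blast
      obtain K where K: "K \<subseteq> N" "finite K" "card K = n"
        using infinite_arbitrarily_large[OF \<open>infinite N\<close>] by blast
      have "real n * (2 * lam)\<^sup>2 = (\<Sum>k\<in>K. (2 * lam)\<^sup>2)"
        using K(3) by simp
      also have "\<dots> \<le> (\<Sum>k\<in>K. (cmod (f1 (x k) - f2 (x k)))\<^sup>2)"
        using K(1) by (intro sum_mono big) blast
      also have "\<dots> \<le> B" by (rule B[OF K(2)])
      finally have "real n * (2 * lam)\<^sup>2 \<le> B" .
      moreover have "B < real n * (2 * lam)\<^sup>2"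
        using n \<open>lam > 0\<close> by (subst pos_divide_less_eq[symmetric]) auto
      ultimately show False by (meson not_le)
    qed
    have Fh: "F (of_real s) = f1 s - f2 s" for s
      by (simp only: Fs h)
    have F0: "F (of_real t) = 0" for t
    proof (rule dense_real_zeros_imp_zero[OF F(1) _ _ assms(5)])
      show "cmod (F z) \<le> C * exp (pi * \<Omega> * \<bar>Im z\<bar>)" for z using F(2)[of z] by simp
      show "finite (range x \<inter> {a..b})" for a b
        using \<delta> sepX by (rule finite_separated_Int_interval)
      show "finite (x ` N)" using \<open>finite N\<close> by simp
      show "F (of_real s) = 0" if "s \<in> range x - x ` N" for s
        using that by (auto simp: Fh N_def)
    qed (use \<open>\<Omega> > 0\<close> in simp)
    show "f1 = f2"
    proof
      fix t
      show "f1 t = f2 t" using F0[of t] unfolding Fh by simp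
    qed
  qed
  ultimately show ?thesis by (intro conjI funcsetI inj_onI)
qed

end
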